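(* Let $C\subseteq\mathbb{P}^n$ be a codimension $2$ complete intersection defined by two sufficiently general forms of degrees $a$ and $b$ respectively, with $a\le b$. For any integer $0\le j<a$ set $$t:=(a-j)(b-j)+j\qquad\text{and}\qquad m:=(a-j)(b-j).$$ Then $\operatorname{adim}(C,t,m)>0$.
   Context: $K$ is an algebraically closed field and $R=K[x_0,\dots,x_n]$. For a closed subscheme $C\subseteq\mathbb{P}^n$, $I_C\subseteq R$ is its saturated homogeneous ideal and $[\,\cdot\,]_t$ denotes the degree $t$ component. $\operatorname{adim}(C,t,m)=\dim[I_C\cap I_P^m]_t$, where $P\in\mathbb{P}^n$ is a general point with ideal $I_P$. "Sufficiently general" forms means that the pair of forms lies in a suitable nonempty Zariski open subset of the space of pairs of forms of degrees $a,b$. *)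

theory Defs
  imports
    Complex_Main
    "HOL-Library.Poly_Mapping"
    "HOL-Library.Extended_Nat"
    "HOL-Computational_Algebra.Polynomial"
begin

section \<open>Polynomials\<close>

type_synonym ('i, 'k) mpoly = "('i \<Rightarrow>\<^sub>0 nat) \<Rightarrow>\<^sub>0 'k"

definition mpoly_eval :: "('i, 'k::comm_ring_1) mpoly \<Rightarrow> ('i \<Rightarrow> 'k) \<Rightarrow> 'k" where
  "mpoly_eval f x = (\<Sum>m\<in>Poly_Mapping.keys f. Poly_Mapping.lookup f m *
     (\<Prod>i\<in>Poly_Mapping.keys m. x i ^ Poly_Mapping.lookup m i))"

definition scale :: "'k::comm_ring_1 \<Rightarrow> ('i, 'k) mpoly \<Rightarrow> ('i, 'k) mpoly" where
  "scale c f = Poly_Mapping.single 0 c * f"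

lemma vector_space_scale: "vector_space (scale :: 'k::field \<Rightarrow> ('i, 'k) mpoly \<Rightarrow> _)"
proof
  fix a b :: 'k and x y :: "('i, 'k) mpoly"
  show "scale a (x + y) = scale a x + scale a y"
    by (simp add: scale_def distrib_left)
  show "scale (a + b) x = scale a x + scale b x"
    by (simp add: scale_def single_add distrib_right)
  show "scale a (scale b x) = scale (a * b) x"
    by (simp add: scale_def mult_single mult.assoc [symmetric])
  show "scale 1 x = x"
    by (simp add: scale_def)
qed

text \<open>The dimension over the coefficient field. As everywhere in the library, infinite-dimensional
  spaces get dimension 0; below it is only applied to subspaces of the space of forms of a fixed
  degree in finitely many variables.\<close>

definition vdim :: "('i, 'k::field) mpoly set \<Rightarrow> nat" where
  "vdim V = vector_space.dim scale V"

definition mdeg :: "('i \<Rightarrow>\<^sub>0 nat) \<Rightarrow> nat" where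
  "mdeg m = (\<Sum>i\<in>Poly_Mapping.keys m. Poly_Mapping.lookup m i)"

text \<open>The ring \<open>R = K[x\<^sub>0,\<dots>,x\<^sub>n]\<close>, as a subring of the polynomials in the variables
  \<open>x\<^sub>0, x\<^sub>1, \<dots>\<close>, and its homogeneous components \<open>[R]\<^sub>d\<close>.\<close>

definition poly_ring :: "nat \<Rightarrow> (nat, 'k::comm_ring_1) mpoly set" where
  "poly_ring n = {f. \<forall>m\<in>Poly_Mapping.keys f. Poly_Mapping.keys m \<subseteq> {..n}}"

definition forms :: "nat \<Rightarrow> nat \<Rightarrow> (nat, 'k::comm_ring_1) mpoly set" where
  "forms n d = {f \<in> poly_ring n. \<forall>m\<in>Poly_Mapping.keys f. mdeg m = d}"

definition var :: "nat \<Rightarrow> (nat, 'k::comm_ring_1) mpoly" where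
  "var i = Poly_Mapping.single (Poly_Mapping.single i 1) 1"


section \<open>Ideals of \<open>R\<close>\<close>

definition gen_ideal :: "nat \<Rightarrow> (nat, 'k::comm_ring_1) mpoly set \<Rightarrow> (nat, 'k) mpoly set" where
  "gen_ideal n S = {\<Sum>g\<in>T. c g * g | T c. finite T \<and> T \<subseteq> S \<and> (\<forall>g\<in>T. c g \<in> poly_ring n)}"

definition ideal_power ::
    "nat \<Rightarrow> (nat, 'k::comm_ring_1) mpoly set \<Rightarrow> nat \<Rightarrow> (nat, 'k) mpoly set" where
  "ideal_power n I m = gen_ideal n {\<Prod>i<m. f i | f. \<forall>i<m. f i \<in> I}"

text \<open>\<open>I : (x\<^sub>0,\<dots>,x\<^sub>n)\<^sup>\<infinity>\<close>\<close>

definition saturation :: "nat \<Rightarrow> (nat, 'k::comm_ring_1) mpoly set \<Rightarrow> (nat, 'k) mpoly set" where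
  "saturation n I =
     {f \<in> poly_ring n. \<exists>k. \<forall>g\<in>ideal_power n (gen_ideal n (var ` {..n})) k. f * g \<in> I}"

text \<open>A closed subscheme of \<open>\<P>\<^sup>n\<close> is represented by its saturated homogeneous ideal. This is
  the ideal of the subscheme cut out by the forms in \<open>S\<close>.\<close>

definition subscheme_ideal :: "nat \<Rightarrow> (nat, 'k::comm_ring_1) mpoly set \<Rightarrow> (nat, 'k) mpoly set" where
  "subscheme_ideal n S = saturation n (gen_ideal n S)"


section \<open>Projective space and its Zariski topology\<close>

text \<open>A point of \<open>\<P>\<^sup>n\<close> is the set of all its homogeneous coordinate vectors; a coordinate vector
  is extended by 0 to all indices above \<open>n\<close>.\<close>

definition proj_space :: "nat \<Rightarrow> (nat \<Rightarrow> 'k::field) set set" where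
  "proj_space n = {{(\<lambda>i. c * x i) | c. c \<noteq> 0} | x. (\<forall>i>n. x i = 0) \<and> (\<exists>i\<le>n. x i \<noteq> 0)}"

definition vanishes_at :: "(nat, 'k::field) mpoly \<Rightarrow> (nat \<Rightarrow> 'k) set \<Rightarrow> bool" where
  "vanishes_at f P \<longleftrightarrow> (\<forall>x\<in>P. mpoly_eval f x = 0)"

definition zero_locus :: "nat \<Rightarrow> (nat, 'k::field) mpoly set \<Rightarrow> (nat \<Rightarrow> 'k) set set" where
  "zero_locus n S = {P \<in> proj_space n. \<forall>f\<in>S. vanishes_at f P}"

definition proj_closed :: "nat \<Rightarrow> (nat \<Rightarrow> 'k::field) set set \<Rightarrow> bool" where
  "proj_closed n Z \<longleftrightarrow> (\<exists>S. S \<subseteq> (\<Union>d. forms n d) \<and> Z = zero_locus n S)"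

definition proj_open :: "nat \<Rightarrow> (nat \<Rightarrow> 'k::field) set set \<Rightarrow> bool" where
  "proj_open n U \<longleftrightarrow> U \<subseteq> proj_space n \<and> proj_closed n (proj_space n - U)"

definition irreducible_closed :: "nat \<Rightarrow> (nat \<Rightarrow> 'k::field) set set \<Rightarrow> bool" where
  "irreducible_closed n Y \<longleftrightarrow> proj_closed n Y \<and> Y \<noteq> {} \<and>
     (\<forall>A B. proj_closed n A \<and> proj_closed n B \<and> Y = A \<union> B \<longrightarrow> Y = A \<or> Y = B)"

text \<open>Codimension in \<open>\<P>\<^sup>n\<close> of a closed subset: the infimum, over its irreducible closed subsets
  \<open>Y\<close>, of the lengths \<open>r\<close> of chains \<open>Y = Y\<^sub>0 \<subset> \<dots> \<subset> Y\<^sub>r\<close> of irreducible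
  closed subsets of \<open>\<P>\<^sup>n\<close>. The empty set has codimension \<open>\<infinity>\<close>.\<close>

definition codim_irreducible :: "nat \<Rightarrow> (nat \<Rightarrow> 'k::field) set set \<Rightarrow> enat" where
  "codim_irreducible n Y = Sup {enat r | r. \<exists>C. C 0 = Y \<and>
     (\<forall>i\<le>r. irreducible_closed n (C i)) \<and> (\<forall>i<r. C i \<subset> C (Suc i))}"

definition codim :: "nat \<Rightarrow> (nat \<Rightarrow> 'k::field) set set \<Rightarrow> enat" where
  "codim n Z = (INF Y\<in>{Y. irreducible_closed n Y \<and> Y \<subseteq> Z}. codim_irreducible n Y)"

text \<open>The subscheme cut out by the listed forms has codimension equal to the number of forms.\<close>

definition complete_intersection :: "nat \<Rightarrow> (nat, 'k::field) mpoly list \<Rightarrow> bool" where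
  "complete_intersection n Fs \<longleftrightarrow> (\<forall>f\<in>set Fs. \<exists>d. f \<in> forms n d) \<and>
     codim n (zero_locus n (set Fs)) = enat (length Fs)"


section \<open>The dimension \<open>adim\<close>\<close>

definition point_ideal :: "nat \<Rightarrow> (nat \<Rightarrow> 'k::field) set \<Rightarrow> (nat, 'k) mpoly set" where
  "point_ideal n P = gen_ideal n {f. (\<exists>d. f \<in> forms n d) \<and> vanishes_at f P}"

text \<open>The value of \<open>dim [I \<inter> I\<^sub>P\<^sup>m]\<^sub>t\<close> at a general point \<open>P\<close>, i.e. the number
  that this dimension equals for all \<open>P\<close> in some nonempty open subset of \<open>\<P>\<^sup>n\<close>.\<close>

definition adim :: "nat \<Rightarrow> (nat, 'k::field) mpoly set \<Rightarrow> nat \<Rightarrow> nat \<Rightarrow> nat" where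
  "adim n I t m = (THE d. \<exists>U. proj_open n U \<and> U \<noteq> {} \<and>
     (\<forall>P\<in>U. vdim (I \<inter> ideal_power n (point_ideal n P) m \<inter> forms n t) = d))"


section \<open>The Zariski topology on pairs of forms\<close>

text \<open>The affine space \<open>[R]\<^sub>a \<times> [R]\<^sub>b\<close>, with the coefficients of the two forms as
  coordinates: the coefficient of the monomial \<open>m\<close> in the first (second) form is the coordinate
  with index \<open>Inl m\<close> (\<open>Inr m\<close>).\<close>

definition pair_coords ::
    "(nat, 'k::field) mpoly \<times> (nat, 'k) mpoly \<Rightarrow> (nat \<Rightarrow>\<^sub>0 nat) + (nat \<Rightarrow>\<^sub>0 nat) \<Rightarrow> 'k" where
  "pair_coords p = case_sum (Poly_Mapping.lookup (fst p)) (Poly_Mapping.lookup (snd p))"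

definition pairs_open ::
    "nat \<Rightarrow> nat \<Rightarrow> nat \<Rightarrow> ((nat, 'k::field) mpoly \<times> (nat, 'k) mpoly) set \<Rightarrow> bool" where
  "pairs_open n a b U \<longleftrightarrow>
     (\<exists>H. U = {p \<in> forms n a \<times> forms n b. \<exists>h\<in>H. mpoly_eval h (pair_coords p) \<noteq> 0})"

end

theory Submission
  imports Defs "Jordan_Normal_Form.Determinant"
begin

text \<open>
  Let \<open>P\<close> be a point with coordinate vector \<open>p\<close>, \<open>p\<^sub>0 \<noteq> 0\<close>. Choose the linear form \<open>z = x\<^sub>0 / p\<^sub>0\<close> and linear
  forms \<open>y\<^sub>i\<close> vanishing at \<open>P\<close>, and regard \<open>F\<close> and \<open>G\<close> as polynomials in \<open>z\<close> over the ring generated by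
  the \<open>y\<^sub>i\<close>. Their \<open>j\<close>-th subresultant \<open>S\<close> lies in the ideal \<open>(F, G)\<close>, is a form of degree
  \<open>t = (a - j) (b - j) + j\<close>, and has degree at most \<open>j\<close> in \<open>z\<close>. Hence every monomial of \<open>S\<close> has degree at
  least \<open>t - j = m\<close> in the \<open>y\<^sub>i\<close>, that is, \<open>S\<close> has multiplicity at least \<open>m\<close> at \<open>P\<close>. This is
  \<open>subresultant_exists\<close>, under the hypothesis that the principal subresultant coefficient of the
  restrictions of \<open>F\<close> and \<open>G\<close> to one line through \<open>P\<close> is nonzero, which ensures \<open>S \<noteq> 0\<close>.

  That hypothesis is an open condition on \<open>F\<close>, \<open>G\<close> and \<open>P\<close>. The open set of pairs of forms consists of those
  which satisfy it for all \<open>j < a\<close> at the fixed point \<open>[1 : 0 : \<dots> : 0]\<close>; each of them then satisfies it on a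
  nonempty open set of points \<open>P\<close>. The set of pairs is nonempty because two univariate polynomials
  whose Euclidean algorithm has all partial quotients after the first of degree 1 have nonzero
  principal subresultant coefficients (\<open>psc_continuant\<close>), and forms restricting to them exist.

  It remains to see that the number \<open>adim\<close> is determined by what happens on any nonempty open set.
  Membership of a form in the \<open>m\<close>-th power of the ideal of \<open>P\<close> is a system of linear equations with
  coefficients polynomial in \<open>p\<close> (\<open>mem_ideal_power_point_iff\<close>), so the dimension is constant on a nonempty
  open set (\<open>generic_dim\<close>), and two nonempty open sets of projective space meet
  (\<open>proj_open_Int_nonempty\<close>).
\<close>

section \<open>Substitution into polynomials\<close>

text \<open>The value at \<open>s\<close> of the monomial with exponent vector \<open>m\<close>.\<close>

definition monom_val :: "('i \<Rightarrow> 'r::comm_ring_1) \<Rightarrow> ('i \<Rightarrow>\<^sub>0 nat) \<Rightarrow> 'r" where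
  "monom_val s m = (\<Prod>i\<in>Poly_Mapping.keys m. s i ^ Poly_Mapping.lookup m i)"

text \<open>The value of \<open>f\<close> at \<open>s\<close> in a commutative ring \<open>'r\<close>, where the coefficients are mapped to \<open>'r\<close> by \<open>c\<close>.
  For \<open>c\<close> the identity this is evaluation; for \<open>c\<close> the embedding of constants it is restriction to a
  curve with polynomial parametrization.\<close>

definition psubst ::
    "('k::comm_ring_1 \<Rightarrow> 'r::comm_ring_1) \<Rightarrow> ('i \<Rightarrow> 'r) \<Rightarrow> ('i, 'k) mpoly \<Rightarrow> 'r" where
  "psubst c s f = (\<Sum>m\<in>Poly_Mapping.keys f. c (Poly_Mapping.lookup f m) * monom_val s m)"

text \<open>The restriction of \<open>f\<close> to the affine line \<open>q + X p\<close>, as a polynomial in \<open>X\<close>. Its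
  coefficients are the Taylor coefficients of \<open>f\<close> at \<open>q\<close> in the direction \<open>p\<close>.\<close>

abbreviation on_line :: "(nat \<Rightarrow> 'k) \<Rightarrow> (nat \<Rightarrow> 'k) \<Rightarrow> (nat, 'k::comm_ring_1) mpoly \<Rightarrow> 'k poly" where
  "on_line q p \<equiv> psubst (\<lambda>a. [:a:]) (\<lambda>i. [:q i, p i:])"

lemma monom_val_superset:
  assumes "finite A" "Poly_Mapping.keys m \<subseteq> A"
  shows "monom_val s m = (\<Prod>i\<in>A. s i ^ Poly_Mapping.lookup m i)"
  unfolding monom_val_def
  by (rule prod.mono_neutral_left) (use assms in \<open>auto simp: in_keys_iff\<close>)

lemma monom_val_zero [simp]: "monom_val s 0 = 1"
  by (simp add: monom_val_def)

lemma monom_val_add: "monom_val s (m + m') = monom_val s m * monom_val s m'"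
proof -
  let ?A = "Poly_Mapping.keys m \<union> Poly_Mapping.keys m'"
  have "monom_val s (m + m') = (\<Prod>i\<in>?A. s i ^ Poly_Mapping.lookup (m + m') i)"
    by (rule monom_val_superset) (auto simp: in_keys_iff lookup_add)
  also have "\<dots> = (\<Prod>i\<in>?A. s i ^ Poly_Mapping.lookup m i) * (\<Prod>i\<in>?A. s i ^ Poly_Mapping.lookup m' i)"
    by (simp add: lookup_add power_add prod.distrib)
  also have "\<dots> = monom_val s m * monom_val s m'"
    by (subst (1 2) monom_val_superset[of ?A]) auto
  finally show ?thesis .
qed

lemma mpoly_eval_psubst: "mpoly_eval f x = psubst (\<lambda>a. a) x f"
  by (simp add: mpoly_eval_def psubst_def monom_val_def)

lemma mpoly_sum_singles:
  "f = (\<Sum>m\<in>Poly_Mapping.keys f. Poly_Mapping.single m (Poly_Mapping.lookup f m))"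
  by (rule poly_mapping_eqI) (auto simp: lookup_sum lookup_single when_def in_keys_iff)

context
  fixes c :: "'k::comm_ring_1 \<Rightarrow> 'r::comm_ring_1" and s :: "'i \<Rightarrow> 'r"
  assumes c: "comm_ring_hom c"
begin

interpretation c: comm_ring_hom c by (rule c)

lemma psubst_superset:
  assumes "finite A" "Poly_Mapping.keys f \<subseteq> A"
  shows "psubst c s f = (\<Sum>m\<in>A. c (Poly_Mapping.lookup f m) * monom_val s m)"
  unfolding psubst_def
  by (rule sum.mono_neutral_left) (use assms in \<open>auto simp: in_keys_iff\<close>)

lemma psubst_zero: "psubst c s 0 = 0"
  by (simp add: psubst_def)

lemma psubst_add: "psubst c s (f + g) = psubst c s f + psubst c s g"
proof -
  let ?A = "Poly_Mapping.keys f \<union> Poly_Mapping.keys g"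
  have 1: "psubst c s (f + g) = (\<Sum>m\<in>?A. c (Poly_Mapping.lookup (f + g) m) * monom_val s m)"
    by (rule psubst_superset) (use keys_add[of f g] in auto)
  have 2: "psubst c s f = (\<Sum>m\<in>?A. c (Poly_Mapping.lookup f m) * monom_val s m)"
    by (rule psubst_superset) auto
  have 3: "psubst c s g = (\<Sum>m\<in>?A. c (Poly_Mapping.lookup g m) * monom_val s m)"
    by (rule psubst_superset) auto
  show ?thesis
    unfolding 1 2 3 by (simp add: lookup_add c.hom_add algebra_simps sum.distrib)
qed

lemma psubst_sum: "psubst c s (sum f A) = (\<Sum>x\<in>A. psubst c s (f x))"
  by (induction A rule: infinite_finite_induct) (auto simp: psubst_zero psubst_add)

lemma psubst_single: "psubst c s (Poly_Mapping.single m a) = c a * monom_val s m"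
  by (simp add: psubst_def)

lemma psubst_mult: "psubst c s (f * g) = psubst c s f * psubst c s g"
proof -
  let ?F = "\<lambda>m. Poly_Mapping.single m (Poly_Mapping.lookup f m)"
  let ?G = "\<lambda>m. Poly_Mapping.single m (Poly_Mapping.lookup g m)"
  have "psubst c s (f * g) =
      psubst c s ((\<Sum>m\<in>Poly_Mapping.keys f. ?F m) * (\<Sum>m\<in>Poly_Mapping.keys g. ?G m))"
    using mpoly_sum_singles[of f] mpoly_sum_singles[of g] by simp
  also have "\<dots> = psubst c s (\<Sum>m\<in>Poly_Mapping.keys f. ?F m) * psubst c s (\<Sum>m\<in>Poly_Mapping.keys g. ?G m)"
    by (simp add: sum_product psubst_sum mult_single psubst_single monom_val_add c.hom_mult mult_ac)
  finally show ?thesis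
    using mpoly_sum_singles[of f] mpoly_sum_singles[of g] by simp
qed

lemma comm_ring_hom_psubst: "comm_ring_hom (psubst c s)"
proof
  show "psubst c s 1 = 1"
    using psubst_single[of 0 1] by simp
qed (simp_all add: psubst_zero psubst_add psubst_mult)

lemma psubst_const: "psubst c s (Poly_Mapping.single 0 a) = c a"
  by (simp add: psubst_single)

lemma psubst_scale: "psubst c s (scale a f) = c a * psubst c s f"
  by (simp add: scale_def psubst_mult psubst_const)

lemma psubst_var: "psubst (c :: 'k \<Rightarrow> 'r) (t :: nat \<Rightarrow> 'r) (var i) = t i"
  by (simp add: var_def psubst_def monom_val_def)

end

lemma comm_ring_hom_ident: "comm_ring_hom (\<lambda>a::'k::comm_ring_1. a)"
  by unfold_locales auto

lemma comm_ring_hom_const_poly: "comm_ring_hom (\<lambda>a::'k::comm_ring_1. [:a:])"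
  by unfold_locales (auto simp: one_pCons)

interpretation mp: vector_space "scale :: 'k::field \<Rightarrow> ('i, 'k) mpoly \<Rightarrow> _"
  by (rule vector_space_scale)

text \<open>The product of the \<open>X - a\<close> over all elements \<open>a\<close> of a finite field, plus 1, has no root.\<close>

lemma infinite_UNIV_alg_closed: "infinite (UNIV :: 'k::alg_closed_field set)"
proof
  assume fin: "finite (UNIV :: 'k set)"
  let ?p = "(\<Prod>a\<in>(UNIV::'k set). [:- a, 1:])"
  have 1: "degree ?p = card (UNIV :: 'k set)"
    by (subst degree_prod_eq_sum_degree) auto
  moreover have "card (UNIV :: 'k set) > 0"
    using fin by (simp add: card_gt_0_iff)
  ultimately have "degree (?p + 1) > 0"
    by (metis degree_add_eq_left degree_1)
  then obtain x where "poly (?p + 1) x = 0"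
    using alg_closed_imp_poly_has_root by blast
  moreover have "poly ?p x = 0"
    using fin by (simp add: poly_prod prod_zero)
  ultimately show False by simp
qed

lemma digits_unique:
  fixes D :: nat
  assumes "\<forall>i<n. u i < D" "\<forall>i<n. v i < D" "(\<Sum>i<n. u i * D ^ i) = (\<Sum>i<n. v i * D ^ i)" "i < n"
  shows "u i = v i"
  using assms
proof (induction n arbitrary: u v i)
  case (Suc n)
  have "u 0 + D * (\<Sum>i<n. u (Suc i) * D ^ i) = v 0 + D * (\<Sum>i<n. v (Suc i) * D ^ i)"
    using Suc.prems(3) unfolding sum.lessThan_Suc_shift by (simp add: sum_distrib_left mult_ac)
  moreover have "u 0 < D" "v 0 < D"
    using Suc.prems by auto
  moreover have "x mod D = a" "x div D = y" if "x = a + D * y" "a < D" for x a y :: nat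
    using that by auto
  ultimately have 0: "u 0 = v 0" and "(\<Sum>i<n. u (Suc i) * D ^ i) = (\<Sum>i<n. v (Suc i) * D ^ i)"
    by metis+
  then show ?case
    using Suc.IH[of "\<lambda>i. u (Suc i)" "\<lambda>i. v (Suc i)" "i - 1"] Suc.prems by (cases i) auto
qed simp

lemma psubst_hom:
  assumes "comm_ring_hom h"
  shows "h (psubst c s f) = psubst (\<lambda>a. h (c a)) (\<lambda>i. h (s i)) f"
proof -
  interpret h: comm_ring_hom h by fact
  show ?thesis
    by (simp add: psubst_def monom_val_def hom_distribs)
qed

lemma exists_nonroot:
  fixes p :: "'k::alg_closed_field poly"
  assumes "p \<noteq> 0"
  obtains x where "poly p x \<noteq> 0"
  using assms infinite_UNIV_alg_closed poly_roots_finite[OF assms]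
  by (metis (mono_tags, lifting) UNIV_eq_I mem_Collect_eq)

text \<open>Over an infinite field a nonzero polynomial is a nonzero function: the Kronecker substitution
  \<open>x\<^sub>i = X ^ (E ^ i)\<close>, with \<open>E\<close> larger than all exponents, sends distinct monomials of \<open>f\<close> to distinct
  powers of \<open>X\<close>.\<close>

lemma mpoly_nonzero_value:
  fixes f :: "(nat, 'k::alg_closed_field) mpoly"
  assumes "f \<noteq> 0"
  obtains x where "mpoly_eval f x \<noteq> 0"
proof -
  let ?M = "Poly_Mapping.keys f"
  let ?I = "\<Union>m\<in>?M. Poly_Mapping.keys m"
  have finI: "finite ?I" by simp
  obtain n where n: "?I \<subseteq> {..<n}"
    using finite_nat_bounded[OF finI] by blast
  have "finite ((\<lambda>(m, i). Poly_Mapping.lookup m i) ` (?M \<times> ?I))"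
    by (rule finite_imageI[OF finite_cartesian_product[OF finite_keys finI]])
  then obtain D where D: "(\<lambda>(m, i). Poly_Mapping.lookup m i) ` (?M \<times> ?I) \<subseteq> {..<D}"
    using finite_nat_bounded by blast
  have D': "Poly_Mapping.lookup m i < max D 1" if "m \<in> ?M" for m i
  proof (cases "i \<in> ?I")
    case True
    then show ?thesis
      using D that by (force simp: image_subset_iff)
  next
    case False
    then have "Poly_Mapping.lookup m i = 0"
      using that by (auto simp: in_keys_iff)
    then show ?thesis by simp
  qed
  define E where "E = max D 1"
  define e where "e m = (\<Sum>i<n. Poly_Mapping.lookup m i * E ^ i)" for m
  have inj: "inj_on e ?M"
  proof (rule inj_onI, rule poly_mapping_eqI)
    fix m m' i assume m: "m \<in> ?M" "m' \<in> ?M" "e m = e m'"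
    show "Poly_Mapping.lookup m i = Poly_Mapping.lookup m' i"
    proof (cases "i < n")
      case True
      then show ?thesis
        using digits_unique[of n "Poly_Mapping.lookup m" E "Poly_Mapping.lookup m'" i] m D'
        by (auto simp: e_def E_def)
    next
      case False
      then have "i \<notin> Poly_Mapping.keys m" "i \<notin> Poly_Mapping.keys m'"
        using n m by auto
      then show ?thesis by (simp add: in_keys_iff)
    qed
  qed
  define g where "g = (\<Sum>m\<in>?M. monom (Poly_Mapping.lookup f m) (e m))"
  have coeff: "coeff g (e m) = Poly_Mapping.lookup f m" if "m \<in> ?M" for m
  proof -
    have "coeff g (e m) = (\<Sum>m'\<in>?M. if m' = m then Poly_Mapping.lookup f m' else 0)"
      unfolding g_def coeff_sum
      by (rule sum.cong) (use inj that in \<open>auto simp: inj_on_def\<close>)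
    then show ?thesis using that by simp
  qed
  obtain m where "m \<in> ?M"
    using assms by fastforce
  then have "g \<noteq> 0"
    using coeff by (metis coeff_0 in_keys_iff)
  then obtain c where c: "poly g c \<noteq> 0"
    by (rule exists_nonroot)
  have "mpoly_eval f (\<lambda>i. c ^ (E ^ i)) = poly g c"
    unfolding mpoly_eval_psubst psubst_def g_def poly_sum poly_monom
  proof (intro sum.cong refl arg_cong2[of _ _ _ _ "(*)"])
    fix m assume m: "m \<in> ?M"
    have "monom_val (\<lambda>i. c ^ (E ^ i)) m = (\<Prod>i<n. (c ^ (E ^ i)) ^ Poly_Mapping.lookup m i)"
      by (rule monom_val_superset) (use n m in auto)
    also have "\<dots> = c ^ e m"
      unfolding e_def power_sum by (simp add: power_mult [symmetric] mult.commute)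
    finally show "monom_val (\<lambda>i. c ^ (E ^ i)) m = c ^ e m" .
  qed
  with c that show ?thesis by metis
qed

section \<open>Polynomial functions\<close>

text \<open>Only the variables in \<open>V\<close> occur in \<open>f\<close>.\<close>

definition in_vars :: "'i set \<Rightarrow> ('i, 'k::comm_ring_1) mpoly \<Rightarrow> bool" where
  "in_vars V f \<longleftrightarrow> (\<forall>m\<in>Poly_Mapping.keys f. Poly_Mapping.keys m \<subseteq> V)"

lemma in_vars_single: "Poly_Mapping.keys m \<subseteq> V \<Longrightarrow> in_vars V (Poly_Mapping.single m a)"
  by (auto simp: in_vars_def split: if_splits)

lemma in_vars_zero: "in_vars V 0"
  by (simp add: in_vars_def)

lemma in_vars_add: "in_vars V f \<Longrightarrow> in_vars V g \<Longrightarrow> in_vars V (f + g)"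
  using keys_add[of f g] by (auto simp: in_vars_def)

lemma in_vars_mult:
  assumes "in_vars V f" "in_vars V g"
  shows "in_vars V (f * g)"
  unfolding in_vars_def
proof
  fix m assume "m \<in> Poly_Mapping.keys (f * g)"
  then obtain a b where "m = a + b" "a \<in> Poly_Mapping.keys f" "b \<in> Poly_Mapping.keys g"
    using keys_mult[of f g] by auto
  then show "Poly_Mapping.keys m \<subseteq> V"
    using assms keys_add[of a b] unfolding in_vars_def by blast
qed

lemma poly_ring_in_vars: "f \<in> poly_ring n \<longleftrightarrow> in_vars {..n} f"
  by (simp add: poly_ring_def in_vars_def)

text \<open>Functions on the full coordinate space given by a polynomial in the coordinates from \<open>V\<close>. Working
  with functions rather than polynomials lets determinants be formed over the field.\<close>

definition polyfun :: "'i set \<Rightarrow> (('i \<Rightarrow> 'k::comm_ring_1) \<Rightarrow> 'k) \<Rightarrow> bool" where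
  "polyfun V g \<longleftrightarrow> (\<exists>h. in_vars V h \<and> (\<forall>x. g x = mpoly_eval h x))"

lemma polyfun_const: "polyfun V (\<lambda>x. a)"
  unfolding polyfun_def
  by (rule exI[of _ "Poly_Mapping.single 0 a"])
    (auto intro: in_vars_single simp: mpoly_eval_psubst psubst_const[OF comm_ring_hom_ident])

lemma polyfun_coord:
  assumes "i \<in> V"
  shows "polyfun V (\<lambda>x. x i)"
  unfolding polyfun_def
proof (intro exI conjI allI)
  show "in_vars V (Poly_Mapping.single (Poly_Mapping.single i 1) 1)"
    by (rule in_vars_single) (use assms in auto)
qed (simp add: mpoly_eval_def)

lemma polyfun_add: "polyfun V f \<Longrightarrow> polyfun V g \<Longrightarrow> polyfun V (\<lambda>x. f x + g x)"
  unfolding polyfun_def mpoly_eval_psubst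
  by (metis in_vars_add psubst_add[OF comm_ring_hom_ident])

lemma polyfun_mult: "polyfun V f \<Longrightarrow> polyfun V g \<Longrightarrow> polyfun V (\<lambda>x. f x * g x)"
  unfolding polyfun_def mpoly_eval_psubst
  by (metis in_vars_mult psubst_mult[OF comm_ring_hom_ident])

lemma polyfun_sum: "(\<And>i. i \<in> A \<Longrightarrow> polyfun V (f i)) \<Longrightarrow> polyfun V (\<lambda>x. \<Sum>i\<in>A. f i x)"
  by (induction A rule: infinite_finite_induct) (auto intro: polyfun_const polyfun_add)

lemma polyfun_prod: "(\<And>i. i \<in> A \<Longrightarrow> polyfun V (f i)) \<Longrightarrow> polyfun V (\<lambda>x. \<Prod>i\<in>A. f i x)"
  by (induction A rule: infinite_finite_induct) (auto intro: polyfun_const polyfun_mult)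

lemma det_mat: "det (mat n n f) =
    (\<Sum>\<sigma>\<in>{\<sigma>. \<sigma> permutes {0..<n}}. signof \<sigma> * (\<Prod>i=0..<n. f (i, \<sigma> i)))"
  unfolding det_def'[OF mat_carrier]
proof (intro sum.cong refl arg_cong2[of _ _ _ _ "(*)"] prod.cong)
  fix \<sigma> i assume "\<sigma> \<in> {\<sigma>. \<sigma> permutes {0..<n}}" "i \<in> {0..<n}"
  then have "i < n" "\<sigma> i < n"
    using permutes_in_image[of \<sigma> "{0..<n}" i] by auto
  then show "mat n n f $$ (i, \<sigma> i) = f (i, \<sigma> i)" by simp
qed

lemma polyfun_det:
  assumes "\<And>i k. i < n \<Longrightarrow> k < n \<Longrightarrow> polyfun V (A i k)"
  shows "polyfun V (\<lambda>x. det (mat n n (\<lambda>(i, k). A i k x)))"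
  unfolding det_mat prod.case
proof (intro polyfun_sum polyfun_mult polyfun_const polyfun_prod assms)
  fix \<sigma> i assume "\<sigma> \<in> {\<sigma>. \<sigma> permutes {0..<n}}" "i \<in> {0..<n}"
  then show "i < n" "\<sigma> i < n"
    using permutes_in_image[of \<sigma> "{0..<n}" i] by auto
qed

text \<open>Families of univariate polynomials whose coefficients are polynomial functions of the parameter.\<close>

definition upolyfun :: "'i set \<Rightarrow> (('i \<Rightarrow> 'k::comm_ring_1) \<Rightarrow> 'k poly) \<Rightarrow> bool" where
  "upolyfun V P \<longleftrightarrow> (\<forall>k. polyfun V (\<lambda>x. coeff (P x) k))"

lemma upolyfun_const: "upolyfun V (\<lambda>x. P)"
  by (simp add: upolyfun_def polyfun_const)

lemma upolyfun_mult: "upolyfun V P \<Longrightarrow> upolyfun V Q \<Longrightarrow> upolyfun V (\<lambda>x. P x * Q x)"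
  unfolding upolyfun_def coeff_mult by (intro allI polyfun_sum polyfun_mult) auto

lemma upolyfun_sum: "(\<And>i. i \<in> A \<Longrightarrow> upolyfun V (P i)) \<Longrightarrow> upolyfun V (\<lambda>x. \<Sum>i\<in>A. P i x)"
  unfolding upolyfun_def coeff_sum by (intro allI polyfun_sum) auto

lemma upolyfun_prod: "(\<And>i. i \<in> A \<Longrightarrow> upolyfun V (P i)) \<Longrightarrow> upolyfun V (\<lambda>x. \<Prod>i\<in>A. P i x)"
  by (induction A rule: infinite_finite_induct) (auto intro: upolyfun_const upolyfun_mult)

lemma upolyfun_power: "upolyfun V P \<Longrightarrow> upolyfun V (\<lambda>x. P x ^ k)"
  by (induction k) (auto intro: upolyfun_const upolyfun_mult)

lemma upolyfun_linear:
  assumes "polyfun V f" "polyfun V g"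
  shows "upolyfun V (\<lambda>x. [:f x, g x:])"
  unfolding upolyfun_def
proof
  fix k
  show "polyfun V (\<lambda>x. coeff [:f x, g x:] k)"
    using assms by (cases k; cases "k - 1") (auto intro: polyfun_const)
qed

lemma upolyfun_psubst:
  assumes "f \<in> poly_ring n" "\<And>i. i \<le> n \<Longrightarrow> upolyfun V (\<lambda>x. s x i)"
  shows "upolyfun V (\<lambda>x. psubst (\<lambda>a. [:a:]) (s x) f)"
  unfolding psubst_def monom_val_def
  using assms
  by (intro upolyfun_sum upolyfun_mult upolyfun_const upolyfun_prod upolyfun_power)
    (auto simp: poly_ring_def)

section \<open>Forms\<close>

lemma mdeg_superset:
  assumes "finite A" "Poly_Mapping.keys m \<subseteq> A"
  shows "mdeg m = (\<Sum>i\<in>A. Poly_Mapping.lookup m i)"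
  unfolding mdeg_def
  by (rule sum.mono_neutral_left) (use assms in \<open>auto simp: in_keys_iff\<close>)

lemma mdeg_add: "mdeg (m + m') = mdeg m + mdeg m'"
proof -
  let ?A = "Poly_Mapping.keys m \<union> Poly_Mapping.keys m'"
  have 1: "mdeg (m + m') = (\<Sum>i\<in>?A. Poly_Mapping.lookup (m + m') i)"
    by (rule mdeg_superset) (auto simp: in_keys_iff lookup_add)
  have 2: "mdeg m = (\<Sum>i\<in>?A. Poly_Mapping.lookup m i)" by (rule mdeg_superset) auto
  have 3: "mdeg m' = (\<Sum>i\<in>?A. Poly_Mapping.lookup m' i)" by (rule mdeg_superset) auto
  show ?thesis unfolding 1 2 3 by (simp add: lookup_add sum.distrib)
qed

lemma monom_val_smult: "monom_val (\<lambda>i. c * s i) m = c ^ mdeg m * monom_val s m"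
  unfolding monom_val_def mdeg_def power_mult_distrib prod.distrib by (simp add: power_sum)

lemma psubst_form_smult:
  assumes "f \<in> forms n d"
  shows "psubst c (\<lambda>i. u * s i) f = u ^ d * psubst c s f"
  unfolding psubst_def monom_val_smult sum_distrib_left
  by (rule sum.cong) (use assms in \<open>auto simp: forms_def\<close>)

lemma mpoly_eval_form_smult:
  "f \<in> forms n d \<Longrightarrow> mpoly_eval f (\<lambda>i. c * x i) = c ^ d * mpoly_eval f x"
  unfolding mpoly_eval_psubst by (rule psubst_form_smult)

lemma forms_zero: "0 \<in> forms n d"
  by (simp add: forms_def poly_ring_def)

lemma forms_add: "f \<in> forms n d \<Longrightarrow> g \<in> forms n d \<Longrightarrow> f + g \<in> forms n d"
  using subsetD[OF keys_add[of f g]] unfolding forms_def poly_ring_def by (simp, meson UnE)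

lemma forms_mult:
  assumes "f \<in> forms n d" "g \<in> forms n e"
  shows "f * g \<in> forms n (d + e)"
proof -
  have "f * g \<in> poly_ring n"
    using assms by (simp add: forms_def poly_ring_in_vars in_vars_mult)
  moreover have "mdeg m = d + e" if m: "m \<in> Poly_Mapping.keys (f * g)" for m
  proof -
    obtain a b where "m = a + b" "a \<in> Poly_Mapping.keys f" "b \<in> Poly_Mapping.keys g"
      using subsetD[OF keys_mult m] by auto
    then show ?thesis
      using assms by (auto simp: forms_def mdeg_add)
  qed
  ultimately show ?thesis by (simp add: forms_def)
qed

lemma forms_single:
  assumes "Poly_Mapping.keys m \<subseteq> {..n}" "mdeg m = d"
  shows "Poly_Mapping.single m a \<in> forms n d"
  using assms by (auto simp: forms_def poly_ring_def)

lemma forms_const: "Poly_Mapping.single 0 a \<in> forms n 0"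
  by (rule forms_single) (auto simp: mdeg_def)

lemma forms_scale: "f \<in> forms n d \<Longrightarrow> scale a f \<in> forms n d"
  unfolding scale_def using forms_mult[OF forms_const] by fastforce

lemma forms_var: "i \<le> n \<Longrightarrow> var i \<in> forms n 1"
  unfolding var_def by (rule forms_single) (auto simp: mdeg_def)

lemma finite_monomials: "finite {m :: nat \<Rightarrow>\<^sub>0 nat. Poly_Mapping.keys m \<subseteq> {..n} \<and> mdeg m = d}"
proof (rule finite_imageD)
  let ?M = "{m :: nat \<Rightarrow>\<^sub>0 nat. Poly_Mapping.keys m \<subseteq> {..n} \<and> mdeg m = d}"
  have "Poly_Mapping.lookup m i \<le> d" if "m \<in> ?M" for m i
  proof (cases "i \<in> Poly_Mapping.keys m")
    case True
    then show ?thesis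
      using that member_le_sum[of i "Poly_Mapping.keys m" "Poly_Mapping.lookup m"]
      by (auto simp: mdeg_def)
  qed (auto simp: in_keys_iff)
  then have "Poly_Mapping.lookup ` ?M \<subseteq> {f. \<forall>i. (i \<in> {..n} \<longrightarrow> f i \<in> {..d}) \<and> (i \<notin> {..n} \<longrightarrow> f i = 0)}"
    by (auto simp: in_keys_iff subset_iff)
  moreover have "finite {f. \<forall>i. (i \<in> {..n} \<longrightarrow> f i \<in> {..d}) \<and> (i \<notin> {..n} \<longrightarrow> f i = (0::nat))}"
    by (rule finite_set_of_finite_funs) auto
  ultimately show "finite (Poly_Mapping.lookup ` ?M)"
    by (rule finite_subset)
  show "inj_on Poly_Mapping.lookup ?M"
    by (rule inj_onI, rule poly_mapping_eqI) simp
qed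

lemma forms_span:
  "\<exists>B. finite B \<and> (forms n d :: (nat, 'k::field) mpoly set) \<subseteq> mp.span B"
proof (intro exI conjI subsetI)
  let ?M = "{m :: nat \<Rightarrow>\<^sub>0 nat. Poly_Mapping.keys m \<subseteq> {..n} \<and> mdeg m = d}"
  let ?B = "(\<lambda>m. Poly_Mapping.single m (1::'k)) ` ?M"
  show "finite ?B" using finite_monomials by blast
  fix f :: "(nat, 'k) mpoly" assume f: "f \<in> forms n d"
  have "(\<Sum>m\<in>Poly_Mapping.keys f. Poly_Mapping.single m (Poly_Mapping.lookup f m)) \<in> mp.span ?B"
  proof (rule mp.span_sum)
    fix m assume "m \<in> Poly_Mapping.keys f"
    then have "Poly_Mapping.single m 1 \<in> mp.span ?B"
      using f by (intro mp.span_base) (auto simp: forms_def poly_ring_def)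
    then have "scale (Poly_Mapping.lookup f m) (Poly_Mapping.single m 1) \<in> mp.span ?B"
      by (rule mp.span_scale)
    then show "Poly_Mapping.single m (Poly_Mapping.lookup f m) \<in> mp.span ?B"
      by (simp add: scale_def mult_single)
  qed
  then show "f \<in> mp.span ?B" using mpoly_sum_singles[of f] by simp
qed

lemma forms_subspace: "mp.subspace (forms n d)"
  by (simp add: mp.subspace_def forms_zero forms_add forms_scale)

section \<open>Ideals and saturation\<close>

lemma poly_ring_zero: "0 \<in> poly_ring n"
  by (simp add: poly_ring_in_vars in_vars_zero)

lemma poly_ring_const: "Poly_Mapping.single 0 a \<in> poly_ring n"
  by (simp add: poly_ring_in_vars in_vars_single)

lemma poly_ring_one: "1 \<in> poly_ring n"
  using poly_ring_const[of 1 n] by simp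

lemma poly_ring_add: "f \<in> poly_ring n \<Longrightarrow> g \<in> poly_ring n \<Longrightarrow> f + g \<in> poly_ring n"
  by (simp add: poly_ring_in_vars in_vars_add)

lemma poly_ring_mult: "f \<in> poly_ring n \<Longrightarrow> g \<in> poly_ring n \<Longrightarrow> f * g \<in> poly_ring n"
  by (simp add: poly_ring_in_vars in_vars_mult)

lemma poly_ring_prod: "(\<And>i. i \<in> A \<Longrightarrow> f i \<in> poly_ring n) \<Longrightarrow> prod f A \<in> poly_ring n"
  by (induction A rule: infinite_finite_induct) (auto intro: poly_ring_one poly_ring_mult)

lemma forms_poly_ring: "f \<in> forms n d \<Longrightarrow> f \<in> poly_ring n"
  by (simp add: forms_def)

lemma gen_ideal_generator_mult:
  assumes "g \<in> S" "r \<in> poly_ring n"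
  shows "r * g \<in> gen_ideal n S"
  unfolding gen_ideal_def using assms by (intro CollectI exI[of _ "{g}"] exI[of _ "\<lambda>_. r"]) auto

lemma gen_ideal_zero: "0 \<in> gen_ideal n S"
  unfolding gen_ideal_def by (intro CollectI exI[of _ "{}"]) auto

lemma gen_ideal_add:
  assumes "f \<in> gen_ideal n S" "f' \<in> gen_ideal n S"
  shows "f + f' \<in> gen_ideal n S"
proof -
  obtain T c where T: "f = (\<Sum>g\<in>T. c g * g)" "finite T" "T \<subseteq> S" "\<forall>g\<in>T. c g \<in> poly_ring n"
    using assms(1) unfolding gen_ideal_def by blast
  obtain T' c' where T': "f' = (\<Sum>g\<in>T'. c' g * g)" "finite T'" "T' \<subseteq> S" "\<forall>g\<in>T'. c' g \<in> poly_ring n"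
    using assms(2) unfolding gen_ideal_def by blast
  let ?c = "\<lambda>g. (if g \<in> T then c g else 0) + (if g \<in> T' then c' g else 0)"
  have 1: "f = (\<Sum>g\<in>T \<union> T'. (if g \<in> T then c g else 0) * g)"
    unfolding T(1) by (rule sum.mono_neutral_cong_left) (use T T' in auto)
  have 2: "f' = (\<Sum>g\<in>T \<union> T'. (if g \<in> T' then c' g else 0) * g)"
    unfolding T'(1) by (rule sum.mono_neutral_cong_left) (use T T' in auto)
  have "f + f' = (\<Sum>g\<in>T \<union> T'. ?c g * g)"
    by (subst 1, subst 2) (simp only: sum.distrib distrib_right)
  then show ?thesis
    unfolding gen_ideal_def
    using T T' by (intro CollectI exI[of _ "T \<union> T'"] exI[of _ ?c]) (auto intro!: poly_ring_add poly_ring_zero)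
qed

lemma gen_ideal_sum: "(\<And>i. i \<in> A \<Longrightarrow> f i \<in> gen_ideal n S) \<Longrightarrow> sum f A \<in> gen_ideal n S"
  by (induction A rule: infinite_finite_induct) (auto intro: gen_ideal_zero gen_ideal_add)

lemma gen_ideal_subset:
  assumes "0 \<in> J" "\<And>f g. f \<in> J \<Longrightarrow> g \<in> J \<Longrightarrow> f + g \<in> J"
    and "\<And>g r. g \<in> S \<Longrightarrow> r \<in> poly_ring n \<Longrightarrow> r * g \<in> J"
  shows "gen_ideal n S \<subseteq> J"
proof -
  have "(\<Sum>g\<in>T. c g * g) \<in> J" if "finite T" "T \<subseteq> S" "\<forall>g\<in>T. c g \<in> poly_ring n" for T c
    using that by (induction T rule: finite_induct) (auto intro: assms)
  then show ?thesis unfolding gen_ideal_def by blast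
qed

lemma gen_ideal_mult:
  fixes f r :: "(nat, 'k::comm_ring_1) mpoly"
  assumes "f \<in> gen_ideal n S" "r \<in> poly_ring n"
  shows "r * f \<in> gen_ideal n S"
proof -
  have "gen_ideal n S \<subseteq> {f. r * f \<in> gen_ideal n S}"
  proof (rule gen_ideal_subset)
    fix g r' :: "(nat, 'k) mpoly"
    assume "g \<in> S" "r' \<in> poly_ring n"
    then show "r' * g \<in> {f. r * f \<in> gen_ideal n S}"
      using gen_ideal_generator_mult[of g S "r * r'" n] assms(2)
      by (simp add: poly_ring_mult mult.assoc)
  qed (auto simp: gen_ideal_zero gen_ideal_add distrib_left)
  then show ?thesis using assms by blast
qed

lemma gen_ideal_poly_ring: "S \<subseteq> poly_ring n \<Longrightarrow> gen_ideal n S \<subseteq> poly_ring n"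
  by (rule gen_ideal_subset) (auto intro: poly_ring_zero poly_ring_add poly_ring_mult)

lemma ideal_power_antimono:
  fixes I :: "(nat, 'k::comm_ring_1) mpoly set"
  assumes I: "I \<subseteq> poly_ring n" and "k \<le> m"
  shows "ideal_power n I m \<subseteq> ideal_power n I k"
  unfolding ideal_power_def
proof (rule gen_ideal_subset)
  fix g r :: "(nat, 'k) mpoly"
  assume "g \<in> {\<Prod>i<m. f i | f. \<forall>i<m. f i \<in> I}" and r: "r \<in> poly_ring n"
  then obtain f where f: "g = (\<Prod>i<m. f i)" "\<forall>i<m. f i \<in> I" by blast
  have "{..<m} = {k..<m} \<union> {..<k}" "{k..<m} \<inter> {..<k} = {}" using \<open>k \<le> m\<close> by auto
  then have "g = (\<Prod>i\<in>{k..<m}. f i) * (\<Prod>i<k. f i)"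
    unfolding f(1) by (simp add: prod.union_disjoint)
  moreover have "(\<Prod>i\<in>{k..<m}. f i) \<in> poly_ring n"
    by (rule poly_ring_prod) (use f I in auto)
  moreover have "(\<Prod>i<k. f i) \<in> {\<Prod>i<k. f i | f. \<forall>i<k. f i \<in> I}"
    using f \<open>k \<le> m\<close> by auto
  ultimately show "r * g \<in> gen_ideal n {\<Prod>i<k. f i | f. \<forall>i<k. f i \<in> I}"
    by (simp only: mult.assoc[symmetric])
      (intro gen_ideal_generator_mult poly_ring_mult r)
qed (auto intro: gen_ideal_zero gen_ideal_add)

lemma ideal_power_zero: "poly_ring n \<subseteq> ideal_power n I 0"
  unfolding ideal_power_def using gen_ideal_generator_mult[of 1] by fastforce

lemma ideal_power_Suc_mult:
  fixes x g :: "(nat, 'k::comm_ring_1) mpoly"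
  assumes "x \<in> I" "g \<in> ideal_power n I s"
  shows "x * g \<in> ideal_power n I (Suc s)"
proof -
  have "gen_ideal n {\<Prod>i<s. f i | f. \<forall>i<s. f i \<in> I} \<subseteq> {g. x * g \<in> ideal_power n I (Suc s)}"
  proof (rule gen_ideal_subset)
    fix g r :: "(nat, 'k) mpoly"
    assume "g \<in> {\<Prod>i<s. f i | f. \<forall>i<s. f i \<in> I}" and r: "r \<in> poly_ring n"
    then obtain f where f: "g = (\<Prod>i<s. f i)" "\<forall>i<s. f i \<in> I" by blast
    have "x * g = (\<Prod>i<Suc s. (f(s := x)) i)"
      unfolding f(1) by (simp add: mult.commute)
    moreover have "\<forall>i<Suc s. (f(s := x)) i \<in> I"
      using f assms(1) by auto
    ultimately have "x * g \<in> {\<Prod>i<Suc s. f i | f. \<forall>i<Suc s. f i \<in> I}" by blast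
    then have "r * (x * g) \<in> ideal_power n I (Suc s)"
      unfolding ideal_power_def by (rule gen_ideal_generator_mult) (rule r)
    then show "r * g \<in> {g. x * g \<in> ideal_power n I (Suc s)}"
      by (simp add: mult.left_commute)
  qed (auto simp: ideal_power_def gen_ideal_zero gen_ideal_add distrib_left)
  then show ?thesis using assms(2) unfolding ideal_power_def by blast
qed

lemma saturation_subspace: "mp.subspace (saturation n (gen_ideal n S))"
proof -
  let ?M = "gen_ideal n (var ` {..n})" and ?J = "gen_ideal n S"
  have M: "?M \<subseteq> poly_ring n"
    by (rule gen_ideal_poly_ring) (auto dest: forms_var forms_poly_ring)
  show ?thesis
    unfolding mp.subspace_def
  proof (intro conjI ballI allI)
    show "0 \<in> saturation n ?J"
      by (simp add: saturation_def poly_ring_zero gen_ideal_zero)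
  next
    fix f g assume fg: "f \<in> saturation n ?J" "g \<in> saturation n ?J"
    then obtain k l where kl: "\<forall>h\<in>ideal_power n ?M k. f * h \<in> ?J" "\<forall>h\<in>ideal_power n ?M l. g * h \<in> ?J"
      unfolding saturation_def by blast
    have "(f + g) * h \<in> ?J" if "h \<in> ideal_power n ?M (max k l)" for h
      using that kl ideal_power_antimono[OF M, of k "max k l"] ideal_power_antimono[OF M, of l "max k l"]
      by (auto simp: distrib_right intro!: gen_ideal_add)
    with fg show "f + g \<in> saturation n ?J"
      unfolding saturation_def by (auto intro: poly_ring_add)
  next
    fix a f assume f: "f \<in> saturation n ?J"
    then obtain k where k: "\<forall>h\<in>ideal_power n ?M k. f * h \<in> ?J"
      unfolding saturation_def by blast
    have "scale a f * h \<in> ?J" if "h \<in> ideal_power n ?M k" for h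
      unfolding scale_def mult.assoc by (rule gen_ideal_mult) (use k that in \<open>auto intro: poly_ring_const\<close>)
    with f show "scale a f \<in> saturation n ?J"
      unfolding saturation_def by (auto simp: scale_def intro!: poly_ring_mult poly_ring_const)
  qed
qed

lemma gen_ideal_saturation:
  assumes "S \<subseteq> poly_ring n"
  shows "gen_ideal n S \<subseteq> saturation n (gen_ideal n S)"
proof
  fix f assume f: "f \<in> gen_ideal n S"
  have "gen_ideal n (var ` {..n}) \<subseteq> poly_ring n"
    by (rule gen_ideal_poly_ring) (auto dest: forms_var forms_poly_ring)
  then have "ideal_power n (gen_ideal n (var ` {..n})) 0 \<subseteq> poly_ring n"
    unfolding ideal_power_def by (intro gen_ideal_poly_ring) (auto intro: poly_ring_one)
  then have "\<forall>g\<in>ideal_power n (gen_ideal n (var ` {..n})) 0. f * g \<in> gen_ideal n S"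
    using gen_ideal_mult[OF f] by (auto simp: mult.commute)
  moreover have "f \<in> poly_ring n"
    using f gen_ideal_poly_ring[OF assms] by blast
  ultimately show "f \<in> saturation n (gen_ideal n S)"
    unfolding saturation_def by blast
qed

lemma subscheme_ideal_subspace: "mp.subspace (subscheme_ideal n S)"
  unfolding subscheme_ideal_def by (rule saturation_subspace)

section \<open>Cones over a point\<close>

text \<open>The point of projective space with coordinate vector \<open>x\<close>.\<close>

definition proj_pt :: "(nat \<Rightarrow> 'k::field) \<Rightarrow> (nat \<Rightarrow> 'k) set" where
  "proj_pt x = {(\<lambda>i. c * x i) | c. c \<noteq> 0}"

lemma proj_pt_self: "x \<in> proj_pt x"
  unfolding proj_pt_def by (intro CollectI exI[of _ 1]) auto

lemma proj_pt_in: "\<forall>i>n. x i = 0 \<Longrightarrow> \<exists>i\<le>n. x i \<noteq> 0 \<Longrightarrow> proj_pt x \<in> proj_space n"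
  unfolding proj_space_def proj_pt_def by blast

lemma proj_spaceD:
  assumes "P \<in> proj_space n" "x \<in> P"
  shows "P = proj_pt x" "\<forall>i>n. x i = 0" "\<exists>i\<le>n. x i \<noteq> 0"
proof -
  obtain y where y: "P = {(\<lambda>i. c * y i) | c. c \<noteq> 0}" "\<forall>i>n. y i = 0" "\<exists>i\<le>n. y i \<noteq> 0"
    using assms unfolding proj_space_def by blast
  then obtain a where a: "a \<noteq> 0" "x = (\<lambda>i. a * y i)"
    using assms by blast
  show "P = proj_pt x"
  proof (intro equalityI subsetI)
    fix v assume "v \<in> P"
    then obtain c where "c \<noteq> 0" "v = (\<lambda>i. c * y i)" using y by blast
    then show "v \<in> proj_pt x"
      using a unfolding proj_pt_def by (intro CollectI exI[of _ "c / a"]) auto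
  next
    fix v assume "v \<in> proj_pt x"
    then obtain c where "c \<noteq> 0" "v = (\<lambda>i. c * x i)" unfolding proj_pt_def by blast
    then show "v \<in> P"
      using a y by (auto intro!: exI[of _ "c * a"])
  qed
  show "\<forall>i>n. x i = 0" "\<exists>i\<le>n. x i \<noteq> 0" using a y by auto
qed

text \<open>For a vector \<open>p\<close> with \<open>p 0 \<noteq> 0\<close> the linear form \<open>z = x\<^sub>0 / p\<^sub>0\<close> takes the value 1 at \<open>p\<close>, and the linear forms
  \<open>y\<^sub>i = x\<^sub>i - p\<^sub>i z\<close> (with \<open>y\<^sub>0 = 0\<close>) vanish at \<open>p\<close> and span, together with \<open>z\<close>, all linear forms.\<close>

definition zform :: "(nat \<Rightarrow> 'k::field) \<Rightarrow> (nat, 'k) mpoly" where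
  "zform p = scale (1 / p 0) (var 0)"

definition yform :: "(nat \<Rightarrow> 'k::field) \<Rightarrow> nat \<Rightarrow> (nat, 'k) mpoly" where
  "yform p i = var i - scale (p i) (zform p)"

text \<open>Forms of degree \<open>s\<close> in the linear forms \<open>y\<^sub>i\<close>, i.e. equations of cones with vertex \<open>p\<close>.\<close>

inductive cone_form :: "nat \<Rightarrow> (nat \<Rightarrow> 'k::field) \<Rightarrow> nat \<Rightarrow> (nat, 'k) mpoly \<Rightarrow> bool" for n p where
  const: "cone_form n p 0 (Poly_Mapping.single 0 a)"
| add: "cone_form n p s f \<Longrightarrow> cone_form n p s g \<Longrightarrow> cone_form n p s (f + g)"
| lin: "i \<le> n \<Longrightarrow> cone_form n p s f \<Longrightarrow> cone_form n p (Suc s) (yform p i * f)"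

lemma cone_form_zero: "cone_form n p s 0"
proof (induction s)
  case 0
  show ?case using cone_form.const[of n p 0] by simp
next
  case (Suc s)
  show ?case using cone_form.lin[OF le0 Suc] by simp
qed

lemma cone_form_const_mult: "cone_form n p s f \<Longrightarrow> cone_form n p s (Poly_Mapping.single 0 a * f)"
proof (induction rule: cone_form.induct)
  case (const b)
  then show ?case by (simp add: mult_single cone_form.const)
next
  case (add s f g)
  then show ?case by (simp add: distrib_left cone_form.add)
next
  case (lin i s f)
  then show ?case by (metis mult.left_commute cone_form.lin)
qed

lemma cone_form_mult: "cone_form n p s f \<Longrightarrow> cone_form n p s' g \<Longrightarrow> cone_form n p (s + s') (f * g)"
proof (induction rule: cone_form.induct)
  case (const b)
  then show ?case by (simp add: cone_form_const_mult)
next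
  case (add s f g)
  then show ?case by (simp add: distrib_right cone_form.add)
next
  case (lin i s f)
  then show ?case by (simp add: mult.assoc cone_form.lin)
qed

lemma cone_form_sum: "(\<And>i. i \<in> A \<Longrightarrow> cone_form n p s (f i)) \<Longrightarrow> cone_form n p s (sum f A)"
  by (induction A rule: infinite_finite_induct) (auto intro: cone_form_zero cone_form.add)

lemma forms_zform: "zform p \<in> forms n 1"
  unfolding zform_def by (intro forms_scale forms_var) simp

lemma forms_yform:
  assumes "i \<le> n"
  shows "yform p i \<in> forms n 1"
  unfolding yform_def
  by (intro mp.subspace_diff[OF forms_subspace] forms_var forms_scale forms_zform assms)

lemma cone_form_forms: "cone_form n p s f \<Longrightarrow> f \<in> forms n s"
proof (induction rule: cone_form.induct)
  case (lin i s f)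
  then show ?case using forms_mult[OF forms_yform] by fastforce
qed (auto intro: forms_const forms_add)

lemma psubst_zform: "comm_ring_hom c \<Longrightarrow> psubst c s (zform p) = c (1 / p 0) * s 0"
  by (simp add: zform_def psubst_scale psubst_var)

lemma psubst_yform:
  assumes "comm_ring_hom c"
  shows "psubst c s (yform p i) = s i - c (p i) * (c (1 / p 0) * s 0)"
proof -
  interpret comm_ring_hom "psubst c s" by (rule comm_ring_hom_psubst) fact
  show ?thesis
    by (simp add: yform_def hom_minus psubst_scale psubst_zform psubst_var assms)
qed

text \<open>A cone form depends only on the values of the \<open>y\<^sub>i\<close>; the next lemmas are instances of this.\<close>

lemma psubst_cone_form_cong:
  assumes c: "comm_ring_hom c" and "cone_form n p d f"
    and "\<And>i. i \<le> n \<Longrightarrow> psubst c s (yform p i) = psubst c t (yform p i)"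
  shows "psubst c s f = psubst c t f"
  using assms(2)
  by (induction rule: cone_form.induct)
    (simp_all add: psubst_const[OF c] psubst_add[OF c] psubst_mult[OF c] assms(3))

lemma psubst_const_poly: "psubst (\<lambda>a. [:a:]) (\<lambda>i. [:q i:]) f = [:mpoly_eval f q:]"
  unfolding mpoly_eval_psubst
  by (rule psubst_hom[symmetric, OF comm_ring_hom_const_poly])

lemma cone_form_line_to:
  assumes "p 0 \<noteq> 0" "cone_form n p d f"
  shows "on_line q p f = [:mpoly_eval f q:]"
proof -
  have "on_line q p f = psubst (\<lambda>a. [:a:]) (\<lambda>i. [:q i:]) f"
    by (rule psubst_cone_form_cong[OF comm_ring_hom_const_poly assms(2)])
      (use assms(1) in \<open>simp add: psubst_yform[OF comm_ring_hom_const_poly]\<close>)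
  then show ?thesis by (simp add: psubst_const_poly)
qed

lemma cone_form_line_from:
  assumes "p 0 \<noteq> 0" "cone_form n p d f"
  shows "on_line p q f = monom (mpoly_eval f q) d"
proof -
  have "on_line p q f = psubst (\<lambda>a. [:a:]) (\<lambda>i. [:0, 1:] * [:q i:]) f"
    by (rule psubst_cone_form_cong[OF comm_ring_hom_const_poly assms(2)])
      (use assms(1) in \<open>simp add: psubst_yform[OF comm_ring_hom_const_poly]\<close>)
  also have "\<dots> = [:0, 1:] ^ d * psubst (\<lambda>a. [:a:]) (\<lambda>i. [:q i:]) f"
    by (rule psubst_form_smult[OF cone_form_forms[OF assms(2)]])
  also have "\<dots> = monom (mpoly_eval f q) d"
    by (simp add: psubst_const_poly monom_altdef)
  finally show ?thesis .
qed

lemma cone_form_eq_0: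
  fixes f :: "(nat, 'k::alg_closed_field) mpoly"
  assumes "p 0 \<noteq> 0" "cone_form n p d f" "\<And>q. q 0 = 0 \<Longrightarrow> mpoly_eval f q = 0"
  shows "f = 0"
proof (rule ccontr)
  assume "f \<noteq> 0"
  then obtain x where x: "mpoly_eval f x \<noteq> 0"
    by (rule mpoly_nonzero_value)
  \<comment> \<open>cone forms are invariant under translation by multiples of \<open>p\<close>\<close>
  have "mpoly_eval f x = mpoly_eval f (\<lambda>i. x i - x 0 / p 0 * p i)"
    unfolding mpoly_eval_psubst
    by (rule psubst_cone_form_cong[OF comm_ring_hom_ident assms(2)])
      (use assms(1) in \<open>simp add: psubst_yform[OF comm_ring_hom_ident] field_simps\<close>)
  also have "\<dots> = 0"
    by (rule assms(3)) (use assms(1) in simp)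
  finally show False using x by simp
qed

text \<open>Expansion of a form \<open>f\<close> of degree \<open>d\<close> in powers of \<open>z\<close>: the coefficient of \<open>z ^ k\<close> is a cone form of
  degree \<open>d - k\<close>. Only its existence is needed.\<close>

definition cone_expansion :: "nat \<Rightarrow> (nat \<Rightarrow> 'k::field) \<Rightarrow> nat \<Rightarrow> (nat, 'k) mpoly \<Rightarrow> bool" where
  "cone_expansion n p d f \<longleftrightarrow> (\<exists>g. (\<forall>k\<le>d. cone_form n p (d - k) (g k)) \<and> f = (\<Sum>k\<le>d. zform p ^ k * g k))"

lemma cone_expansion_add:
  assumes "cone_expansion n p d f" "cone_expansion n p d f'"
  shows "cone_expansion n p d (f + f')"
proof -
  obtain g where g: "\<forall>k\<le>d. cone_form n p (d - k) (g k)" "f = (\<Sum>k\<le>d. zform p ^ k * g k)"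
    using assms(1) unfolding cone_expansion_def by blast
  obtain g' where g': "\<forall>k\<le>d. cone_form n p (d - k) (g' k)" "f' = (\<Sum>k\<le>d. zform p ^ k * g' k)"
    using assms(2) unfolding cone_expansion_def by blast
  show ?thesis
    unfolding cone_expansion_def
    by (rule exI[of _ "\<lambda>k. g k + g' k"])
      (use g g' in \<open>auto intro: cone_form.add simp: distrib_left sum.distrib\<close>)
qed

lemma cone_expansion_zero: "cone_expansion n p d 0"
  unfolding cone_expansion_def by (rule exI[of _ "\<lambda>_. 0"]) (simp add: cone_form_zero)

lemma cone_expansion_sum:
  "(\<And>i. i \<in> A \<Longrightarrow> cone_expansion n p d (f i)) \<Longrightarrow> cone_expansion n p d (sum f A)"
  by (induction A rule: infinite_finite_induct) (auto intro: cone_expansion_zero cone_expansion_add)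

lemma cone_expansion_var_mult:
  assumes "cone_expansion n p d f" "i \<le> n"
  shows "cone_expansion n p (Suc d) (var i * f)"
proof -
  obtain g where g: "\<forall>k\<le>d. cone_form n p (d - k) (g k)" "f = (\<Sum>k\<le>d. zform p ^ k * g k)"
    using assms(1) unfolding cone_expansion_def by blast
  have "cone_expansion n p (Suc d) (yform p i * f)"
    unfolding cone_expansion_def
  proof (intro exI conjI allI impI)
    fix k assume "k \<le> Suc d"
    then show "cone_form n p (Suc d - k) (if k \<le> d then yform p i * g k else 0)"
      using g(1) assms(2) by (auto simp: Suc_diff_le intro: cone_form.lin cone_form_zero)
  next
    show "yform p i * f = (\<Sum>k\<le>Suc d. zform p ^ k * (if k \<le> d then yform p i * g k else 0))"
      unfolding g(2) by (simp add: sum_distrib_left mult_ac)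
  qed
  moreover have "cone_expansion n p (Suc d) (Poly_Mapping.single 0 (p i) * (zform p * f))"
    unfolding cone_expansion_def
  proof (intro exI conjI allI impI)
    fix k assume "k \<le> Suc d"
    then show "cone_form n p (Suc d - k) (if k = 0 then 0 else Poly_Mapping.single 0 (p i) * g (k - 1))"
      using g(1) by (cases k) (auto intro: cone_form_const_mult cone_form_zero)
  next
    show "Poly_Mapping.single 0 (p i) * (zform p * f) =
        (\<Sum>k\<le>Suc d. zform p ^ k * (if k = 0 then 0 else Poly_Mapping.single 0 (p i) * g (k - 1)))"
      unfolding g(2) sum.atMost_Suc_shift by (simp add: sum_distrib_left mult_ac)
  qed
  moreover have "var i * f = yform p i * f + Poly_Mapping.single 0 (p i) * (zform p * f)"
    by (simp add: yform_def scale_def algebra_simps)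
  ultimately show ?thesis
    by (metis cone_expansion_add)
qed

lemma cone_expansion_monomial:
  assumes "Poly_Mapping.keys m \<subseteq> {..n}" "mdeg m = d"
  shows "cone_expansion n p d (Poly_Mapping.single m a)"
  using assms
proof (induction d arbitrary: m)
  case 0
  then have "m = 0"
    by (intro poly_mapping_eqI) (auto simp: mdeg_def in_keys_iff)
  then show ?case
    unfolding cone_expansion_def by (intro exI[of _ "\<lambda>_. Poly_Mapping.single 0 a"]) (auto intro: cone_form.const)
next
  case (Suc d)
  then have "m \<noteq> 0" by (auto simp: mdeg_def)
  then obtain i where i: "i \<in> Poly_Mapping.keys m"
    by (metis all_not_in_conv keys_eq_empty)
  define m' where "m' = m - Poly_Mapping.single i 1"
  have m: "m = Poly_Mapping.single i 1 + m'"
    by (rule poly_mapping_eqI) (use i in \<open>auto simp: m'_def lookup_add lookup_minus lookup_single in_keys_iff when_def\<close>)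
  have "Poly_Mapping.keys m' \<subseteq> {..n}"
    using Suc.prems(1) by (subst (asm) m) (auto simp: in_keys_iff lookup_add subset_iff)
  moreover have "mdeg m' = d"
    using Suc.prems(2) by (subst (asm) m) (simp add: mdeg_add, simp add: mdeg_def)
  ultimately have "cone_expansion n p (Suc d) (var i * Poly_Mapping.single m' a)"
    using Suc.prems(1) i by (intro cone_expansion_var_mult Suc.IH) auto
  then show ?case
    by (simp add: var_def mult_single m[symmetric, simplified])
qed

lemma cone_expansion_form:
  assumes "f \<in> forms n d"
  shows "cone_expansion n p d f"
  by (subst mpoly_sum_singles, intro cone_expansion_sum cone_expansion_monomial)
    (use assms in \<open>auto simp: forms_def poly_ring_def\<close>)

section \<open>Powers of the ideal of a point\<close>

lemma point_ideal_poly_ring: "point_ideal n P \<subseteq> poly_ring n"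
  unfolding point_ideal_def by (rule gen_ideal_poly_ring) (auto dest: forms_poly_ring)

lemma yform_point_ideal:
  assumes "p 0 \<noteq> 0" "i \<le> n"
  shows "yform p i \<in> point_ideal n (proj_pt p)"
proof -
  have "vanishes_at (yform p i) (proj_pt p)"
    unfolding vanishes_at_def proj_pt_def mpoly_eval_psubst
    using assms(1) by (auto simp: psubst_yform[OF comm_ring_hom_ident])
  then have "1 * yform p i \<in> point_ideal n (proj_pt p)"
    unfolding point_ideal_def
    by (intro gen_ideal_generator_mult poly_ring_one) (use forms_yform[OF assms(2)] in blast)
  then show ?thesis by simp
qed

lemma cone_form_ideal_power:
  assumes "p 0 \<noteq> 0" "cone_form n p s f"
  shows "f \<in> ideal_power n (point_ideal n (proj_pt p)) s"
  using assms(2)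
proof (induction rule: cone_form.induct)
  case (const a)
  then show ?case using ideal_power_zero poly_ring_const by blast
next
  case (add s f g)
  then show ?case unfolding ideal_power_def by (intro gen_ideal_add)
next
  case (lin i s f)
  then show ?case by (intro ideal_power_Suc_mult yform_point_ideal assms(1))
qed

lemma point_ideal_eval:
  assumes "f \<in> point_ideal n (proj_pt p)"
  shows "mpoly_eval f p = 0"
proof -
  have "point_ideal n (proj_pt p) \<subseteq> {f. mpoly_eval f p = 0}"
    unfolding point_ideal_def mpoly_eval_psubst
    by (rule gen_ideal_subset)
      (use proj_pt_self[of p] in \<open>auto simp: vanishes_at_def mpoly_eval_psubst
         psubst_zero[OF comm_ring_hom_ident] psubst_add[OF comm_ring_hom_ident] psubst_mult[OF comm_ring_hom_ident]\<close>)
  then show ?thesis using assms by blast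
qed

lemma ideal_power_point_dvd:
  assumes "f \<in> ideal_power n (point_ideal n (proj_pt p)) m"
  shows "[:0, 1:] ^ m dvd on_line p q f"
proof -
  let ?e = "on_line p q"
  interpret e: comm_ring_hom ?e
    by (rule comm_ring_hom_psubst[OF comm_ring_hom_const_poly])
  have 1: "[:0, 1:] dvd ?e f" if "f \<in> point_ideal n (proj_pt p)" for f
  proof -
    have "comm_ring_hom (\<lambda>P :: 'a poly. poly P 0)" by unfold_locales auto
    then have "poly (?e f) 0 = mpoly_eval f p"
      by (subst psubst_hom) (simp_all add: mpoly_eval_psubst)
    then show ?thesis
      using point_ideal_eval[OF that] by (simp add: poly_eq_0_iff_dvd)
  qed
  have "ideal_power n (point_ideal n (proj_pt p)) m \<subseteq> {f. [:0, 1:] ^ m dvd ?e f}"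
    unfolding ideal_power_def
  proof (rule gen_ideal_subset)
    fix g r :: "(nat, 'a) mpoly"
    assume "g \<in> {\<Prod>i<m. f i | f. \<forall>i<m. f i \<in> point_ideal n (proj_pt p)}"
    then obtain f where f: "g = (\<Prod>i<m. f i)" "\<forall>i<m. f i \<in> point_ideal n (proj_pt p)" by blast
    have "(\<Prod>i<m. [:0, 1:]) dvd (\<Prod>i<m. ?e (f i))"
      by (rule prod_dvd_prod) (use f 1 in auto)
    then show "r * g \<in> {f. [:0, 1:] ^ m dvd ?e f}"
      by (simp add: f(1) e.hom_mult e.hom_prod dvd_mult)
  qed (auto simp: e.hom_add)
  then show ?thesis using assms by blast
qed

text \<open>The forms in the \<open>m\<close>-th power of the ideal of a point \<open>p\<close> are those that vanish to order \<open>m\<close> at \<open>p\<close> along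
  every line. In this form membership is a system of linear equations in \<open>f\<close> whose coefficients are
  polynomials in \<open>p\<close>, in every characteristic. For the converse direction, vanishing along the lines
  in the directions \<open>q\<close> with \<open>q\<^sub>0 = 0\<close> kills all terms \<open>z ^ k * g\<^sub>k\<close> of the expansion with \<open>t - k < m\<close>.\<close>

lemma mem_ideal_power_point_iff:
  fixes f :: "(nat, 'k::alg_closed_field) mpoly"
  assumes p: "p 0 \<noteq> 0" and f: "f \<in> forms n t"
  shows "f \<in> ideal_power n (point_ideal n (proj_pt p)) m \<longleftrightarrow>
    (\<forall>q. \<forall>k<m. coeff (on_line p q f) k = 0)"
proof
  assume "f \<in> ideal_power n (point_ideal n (proj_pt p)) m"
  then have "monom 1 m dvd on_line p q f" for q
    using ideal_power_point_dvd[of f n p m q] by (simp add: monom_altdef)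
  then show "\<forall>q. \<forall>k<m. coeff (on_line p q f) k = 0"
    unfolding monom_1_dvd_iff' by blast
next
  assume R: "\<forall>q. \<forall>k<m. coeff (on_line p q f) k = 0"
  obtain g where g: "\<forall>k\<le>t. cone_form n p (t - k) (g k)" "f = (\<Sum>k\<le>t. zform p ^ k * g k)"
    using cone_expansion_form[OF f] unfolding cone_expansion_def by blast
  have g0: "g k = 0" if k: "k \<le> t" "t - k < m" for k
  proof (rule cone_form_eq_0[where p = p, OF p])
    show "cone_form n p (t - k) (g k)" using g(1) k by blast
    fix q :: "nat \<Rightarrow> 'k" assume q: "q 0 = 0"
    let ?e = "on_line p q"
    interpret e: comm_ring_hom ?e
      by (rule comm_ring_hom_psubst[OF comm_ring_hom_const_poly])
    have "?e (zform p) = 1"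
      using p q by (simp add: psubst_zform[OF comm_ring_hom_const_poly] one_pCons)
    then have ef: "?e f = (\<Sum>l\<le>t. monom (mpoly_eval (g l) q) (t - l))"
      unfolding g(2) e.hom_sum e.hom_mult e.hom_power
      by (intro sum.cong refl) (use g(1) cone_form_line_from[of p] p in auto)
    have "coeff (?e f) (t - k) = (\<Sum>l\<le>t. if l = k then mpoly_eval (g l) q else 0)"
      unfolding ef coeff_sum by (rule sum.cong) (use k in auto)
    also have "\<dots> = mpoly_eval (g k) q" using k by simp
    finally show "mpoly_eval (g k) q = 0"
      using R k by simp
  qed
  have "zform p ^ k * g k \<in> ideal_power n (point_ideal n (proj_pt p)) m" if k: "k \<le> t" for k
  proof (cases "t - k < m")
    case True
    then show ?thesis using g0 k by (simp add: ideal_power_def gen_ideal_zero)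
  next
    case False
    then have "g k \<in> ideal_power n (point_ideal n (proj_pt p)) m"
      using cone_form_ideal_power[of p n "t - k" "g k"] p g(1) k
        ideal_power_antimono[OF point_ideal_poly_ring, of m "t - k"] by auto
    moreover have "zform p ^ k \<in> poly_ring n"
      using poly_ring_prod[of "{..<k}" "\<lambda>_. zform p" n] forms_poly_ring[OF forms_zform, of p n] by simp
    ultimately show ?thesis
      unfolding ideal_power_def by (intro gen_ideal_mult)
  qed
  then show "f \<in> ideal_power n (point_ideal n (proj_pt p)) m"
    unfolding g(2) ideal_power_def by (intro gen_ideal_sum) auto
qed

section \<open>Open sets of projective space\<close>

text \<open>The homogeneous component of degree \<open>d\<close>.\<close>

definition hom_component :: "nat \<Rightarrow> (nat, 'k::field) mpoly \<Rightarrow> (nat, 'k) mpoly" where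
  "hom_component d h = (\<Sum>m\<in>{m\<in>Poly_Mapping.keys h. mdeg m = d}. Poly_Mapping.single m (Poly_Mapping.lookup h m))"

lemma hom_component_forms: "h \<in> poly_ring n \<Longrightarrow> hom_component d h \<in> forms n d"
  unfolding hom_component_def
  by (intro mp.subspace_sum forms_single forms_subspace) (auto simp: poly_ring_def)

lemma sum_hom_component:
  assumes "\<forall>m\<in>Poly_Mapping.keys h. mdeg m \<le> D"
  shows "h = (\<Sum>d\<le>D. hom_component d h)"
proof -
  have "(\<Sum>d\<le>D. hom_component d h) =
      (\<Sum>m\<in>Poly_Mapping.keys h. Poly_Mapping.single m (Poly_Mapping.lookup h m))"
    unfolding hom_component_def by (rule sum.group) (use assms in auto)
  then show ?thesis using mpoly_sum_singles[of h] by simp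
qed

text \<open>The polynomial \<open>h\<close> need not be homogeneous: as the base field is infinite, \<open>h\<close> vanishes on a whole
  punctured line through 0 iff all its homogeneous components do.\<close>

lemma proj_open_nonvanishing:
  fixes h :: "(nat, 'k::alg_closed_field) mpoly"
  assumes h: "h \<in> poly_ring n"
  shows "proj_open n {P \<in> proj_space n. \<exists>x\<in>P. mpoly_eval h x \<noteq> 0}"
  unfolding proj_open_def proj_closed_def
proof (intro conjI exI)
  let ?U = "{P \<in> proj_space n. \<exists>x\<in>P. mpoly_eval h x \<noteq> 0}"
  let ?S = "range (\<lambda>d. hom_component d h)"
  show "?U \<subseteq> proj_space n" by auto
  show "?S \<subseteq> (\<Union>d. forms n d)" using hom_component_forms[OF h] by auto
  obtain D where D: "\<forall>m\<in>Poly_Mapping.keys h. mdeg m \<le> D"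
    using finite_nat_set_iff_bounded_le[of "mdeg ` Poly_Mapping.keys h"] by auto
  have hc: "mpoly_eval h (\<lambda>i. c * x i) = (\<Sum>d\<le>D. c ^ d * mpoly_eval (hom_component d h) x)" for c x
  proof -
    have "mpoly_eval h (\<lambda>i. c * x i) = (\<Sum>d\<le>D. mpoly_eval (hom_component d h) (\<lambda>i. c * x i))"
      by (subst sum_hom_component[OF D]) (simp add: mpoly_eval_psubst psubst_sum[OF comm_ring_hom_ident])
    also have "\<dots> = (\<Sum>d\<le>D. c ^ d * mpoly_eval (hom_component d h) x)"
      using mpoly_eval_form_smult[OF hom_component_forms[OF h]] by simp
    finally show ?thesis .
  qed
  show "proj_space n - ?U = zero_locus n ?S"
  proof (intro equalityI subsetI)
    fix P assume P: "P \<in> proj_space n - ?U"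
    have "mpoly_eval (hom_component d h) x = 0" if x: "x \<in> P" for d x
    proof -
      define g where "g = (\<Sum>d\<le>D. monom (mpoly_eval (hom_component d h) x) d)"
      have "poly g c = 0" if "c \<noteq> 0" for c
      proof -
        have "(\<lambda>i. c * x i) \<in> P"
          using proj_spaceD(1)[of P n x] P x that unfolding proj_pt_def by auto
        then have "mpoly_eval h (\<lambda>i. c * x i) = 0" using P by auto
        then show ?thesis
          by (simp add: g_def poly_sum poly_monom hc mult.commute)
      qed
      \<comment> \<open>the factor \<open>X\<close> takes care of \<open>c = 0\<close>, which is not a scaling\<close>
      then have "poly ([:0, 1:] * g) c = 0" for c by (cases "c = 0") auto
      then have "[:0, 1:] * g = 0"
        using exists_nonroot by metis
      then have "g = 0" by simp
      show ?thesis
      proof (cases "d \<le> D")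
        case True
        have "coeff g d = mpoly_eval (hom_component d h) x"
          using True by (simp add: g_def coeff_sum)
        with \<open>g = 0\<close> show ?thesis by simp
      next
        case False
        then have "hom_component d h = 0"
          using D unfolding hom_component_def by (intro sum.neutral) auto
        then show ?thesis by (simp add: mpoly_eval_def)
      qed
    qed
    then show "P \<in> zero_locus n ?S"
      using P unfolding zero_locus_def vanishes_at_def by auto
  next
    fix P assume P: "P \<in> zero_locus n ?S"
    have "mpoly_eval h x = 0" if "x \<in> P" for x
      using hc[of 1 x] P that unfolding zero_locus_def vanishes_at_def by simp
    then show "P \<in> proj_space n - ?U"
      using P unfolding zero_locus_def by auto
  qed
qed

text \<open>Every point of an open set has a basic open neighbourhood, the complement of a hypersurface.\<close>

lemma proj_open_form:
  assumes "proj_open n U" "P \<in> U"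
  obtains f d x where "f \<in> forms n d" "x \<in> P" "mpoly_eval f x \<noteq> 0"
    "{Q \<in> proj_space n. \<not> vanishes_at f Q} \<subseteq> U"
proof -
  obtain S where S: "S \<subseteq> (\<Union>d. forms n d)" "proj_space n - U = zero_locus n S" "U \<subseteq> proj_space n"
    using assms(1) unfolding proj_open_def proj_closed_def by blast
  then have "P \<notin> zero_locus n S" "P \<in> proj_space n" using assms(2) by auto
  then obtain f where f: "f \<in> S" "\<not> vanishes_at f P" unfolding zero_locus_def by blast
  moreover have "{Q \<in> proj_space n. \<not> vanishes_at f Q} \<subseteq> U"
    using S(2) f(1) unfolding zero_locus_def by blast
  ultimately show ?thesis
    using that S(1) unfolding vanishes_at_def by blast
qed

text \<open>Projective space is irreducible. On the line through a point of \<open>U\<close> and a point of \<open>V\<close> the two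
  hypersurfaces to be avoided cut out finitely many points only.\<close>

lemma proj_open_Int_nonempty:
  fixes U V :: "(nat \<Rightarrow> 'k::alg_closed_field) set set"
  assumes U: "proj_open n U" "U \<noteq> {}" and V: "proj_open n V" "V \<noteq> {}"
  shows "U \<inter> V \<noteq> {}"
proof -
  obtain P Q where PQ: "P \<in> U" "Q \<in> V" using U V by blast
  then have P: "P \<in> proj_space n" and Q: "Q \<in> proj_space n"
    using U V unfolding proj_open_def by blast+
  obtain f d x where f: "f \<in> forms n d" "x \<in> P" "mpoly_eval f x \<noteq> 0"
      "{Q \<in> proj_space n. \<not> vanishes_at f Q} \<subseteq> U"
    by (rule proj_open_form[OF U(1) PQ(1)])
  obtain g e y where g: "g \<in> forms n e" "y \<in> Q" "mpoly_eval g y \<noteq> 0"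
      "{Q \<in> proj_space n. \<not> vanishes_at g Q} \<subseteq> V"
    by (rule proj_open_form[OF V(1) PQ(2)])
  have x: "P = proj_pt x" "\<forall>i>n. x i = 0" "\<exists>i\<le>n. x i \<noteq> 0"
    by (fact proj_spaceD[OF P f(2)])+
  have y: "Q = proj_pt y" "\<forall>i>n. y i = 0" "\<exists>i\<le>n. y i \<noteq> 0"
    by (fact proj_spaceD[OF Q g(2)])+
  show ?thesis
  proof (cases "P = Q")
    case True
    then show ?thesis using PQ by auto
  next
    case False
    let ?e = "psubst (\<lambda>a. [:a:]) (\<lambda>i. [:x i, y i - x i:])"
    have hom: "comm_ring_hom (\<lambda>P :: 'k poly. poly P c)" for c by unfold_locales auto
    have e: "poly (?e h) c = mpoly_eval h (\<lambda>i. x i + c * (y i - x i))" for h c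
      by (subst psubst_hom[OF hom]) (simp add: mpoly_eval_psubst mult.commute)
    have "poly (?e f) 0 \<noteq> 0" "poly (?e g) 1 \<noteq> 0"
      using f g by (simp_all add: e)
    then have "?e f * ?e g \<noteq> 0" by auto
    then obtain c where c: "poly (?e f * ?e g) c \<noteq> 0" by (rule exists_nonroot)
    define v where "v = (\<lambda>i. x i + c * (y i - x i))"
    have "\<exists>i\<le>n. v i \<noteq> 0"
    proof (rule ccontr)
      assume "\<not> (\<exists>i\<le>n. v i \<noteq> 0)"
      then have v0: "v i = 0" for i
        using x(2) y(2) by (cases "i \<le> n") (auto simp: v_def)
      have eq: "(1 - c) * x i + c * y i = 0" for i
        using v0[of i] by (simp add: v_def algebra_simps)
      have "c \<noteq> 0" "c \<noteq> 1"
        using eq x(3) y(3) by auto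
      then have "y i = ((c - 1) / c) * x i" for i
        using eq[of i] by (simp add: field_simps)
      then have "y = (\<lambda>i. ((c - 1) / c) * x i)" "(c - 1) / c \<noteq> 0"
        using \<open>c \<noteq> 0\<close> \<open>c \<noteq> 1\<close> by auto
      then have "y \<in> P"
        unfolding x(1) proj_pt_def by blast
      then have "P = Q"
        using proj_spaceD(1)[OF P] y(1) by blast
      with False show False by simp
    qed
    moreover have "\<forall>i>n. v i = 0" using x(2) y(2) by (auto simp: v_def)
    ultimately have v: "proj_pt v \<in> proj_space n" by (intro proj_pt_in)
    moreover have "\<not> vanishes_at f (proj_pt v)" "\<not> vanishes_at g (proj_pt v)"
      using c proj_pt_self[of v] unfolding vanishes_at_def by (auto simp: e v_def)
    ultimately show ?thesis using f(4) g(4) by blast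
  qed
qed

section \<open>Generic constancy of the dimension\<close>

lemma det_nonzero_kernel:
  fixes A :: "nat \<Rightarrow> nat \<Rightarrow> 'k::field"
  shows "det (mat r r (\<lambda>(i, k). A i k)) \<noteq> 0 \<longleftrightarrow>
    (\<forall>c. (\<forall>i<r. (\<Sum>k<r. A i k * c k) = 0) \<longrightarrow> (\<forall>k<r. c k = 0))"
proof -
  let ?M = "mat r r (\<lambda>(i, k). A i k)"
  have mult: "(?M *\<^sub>v v) $ i = (\<Sum>k<r. A i k * v $ k)" if "v \<in> carrier_vec r" "i < r" for v i
    using that by (auto simp: scalar_prod_def atLeast0LessThan intro!: sum.cong)
  have "det ?M = 0 \<longleftrightarrow> (\<exists>v. v \<in> carrier_vec r \<and> v \<noteq> 0\<^sub>v r \<and> ?M *\<^sub>v v = 0\<^sub>v r)"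
    by (rule det_0_iff_vec_prod_zero_field) simp
  also have "\<dots> \<longleftrightarrow> (\<exists>c. (\<forall>i<r. (\<Sum>k<r. A i k * c k) = 0) \<and> (\<exists>k<r. c k \<noteq> 0))"
  proof
    assume "\<exists>v. v \<in> carrier_vec r \<and> v \<noteq> 0\<^sub>v r \<and> ?M *\<^sub>v v = 0\<^sub>v r"
    then obtain v where v: "v \<in> carrier_vec r" "v \<noteq> 0\<^sub>v r" "?M *\<^sub>v v = 0\<^sub>v r" by blast
    have "\<exists>k<r. v $ k \<noteq> 0" using v(1,2) by (auto simp: vec_eq_iff)
    moreover have "\<forall>i<r. (\<Sum>k<r. A i k * v $ k) = 0"
      using mult[OF v(1)] v(3) by simp
    ultimately show "\<exists>c. (\<forall>i<r. (\<Sum>k<r. A i k * c k) = 0) \<and> (\<exists>k<r. c k \<noteq> 0)" by blast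
  next
    assume "\<exists>c. (\<forall>i<r. (\<Sum>k<r. A i k * c k) = 0) \<and> (\<exists>k<r. c k \<noteq> 0)"
    then obtain c where c: "\<forall>i<r. (\<Sum>k<r. A i k * c k) = 0" "\<exists>k<r. c k \<noteq> 0" by blast
    have "?M *\<^sub>v vec r c = 0\<^sub>v r"
      by (rule eq_vecI) (use c(1) in \<open>auto simp: mult simp del: index_mult_mat_vec\<close>)
    moreover have "vec r c \<noteq> 0\<^sub>v r" using c(2) by (auto simp: vec_eq_iff)
    ultimately show "\<exists>v. v \<in> carrier_vec r \<and> v \<noteq> 0\<^sub>v r \<and> ?M *\<^sub>v v = 0\<^sub>v r" by (metis vec_carrier)
  qed
  finally show ?thesis by blast
qed

lemma det_nonzero_solve:
  fixes A :: "nat \<Rightarrow> nat \<Rightarrow> 'k::field"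
  assumes "det (mat r r (\<lambda>(i, k). A i k)) \<noteq> 0"
  obtains c where "\<forall>i<r. (\<Sum>k<r. A i k * c k) = b i"
proof -
  let ?M = "mat r r (\<lambda>(i, k). A i k)"
  let ?v = "(1 / det ?M) \<cdot>\<^sub>v (adj_mat ?M *\<^sub>v vec r b)"
  have M: "?M \<in> carrier_mat r r" by simp
  note adj = adj_mat[OF M]
  have v: "?v \<in> carrier_vec r"
    using adj(1) by (intro smult_carrier_vec[THEN iffD2] mult_mat_vec_carrier) auto
  have "?M *\<^sub>v ?v = (1 / det ?M) \<cdot>\<^sub>v (?M *\<^sub>v (adj_mat ?M *\<^sub>v vec r b))"
    by (rule mult_mat_vec[OF M]) (use adj(1) in \<open>intro mult_mat_vec_carrier, auto\<close>)
  also have "?M *\<^sub>v (adj_mat ?M *\<^sub>v vec r b) = (?M * adj_mat ?M) *\<^sub>v vec r b"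
    by (rule assoc_mult_mat_vec[symmetric, OF M adj(1)]) simp
  also have "\<dots> = det ?M \<cdot>\<^sub>v vec r b"
    unfolding adj(2) by (auto intro!: eq_vecI)
  also have "(1 / det ?M) \<cdot>\<^sub>v (det ?M \<cdot>\<^sub>v vec r b) = vec r b"
    using assms by (auto intro!: eq_vecI)
  finally have "?M *\<^sub>v ?v = vec r b" .
  with v obtain w where w: "w \<in> carrier_vec r" and eq: "?M *\<^sub>v w = vec r b"
    by blast
  have "(\<Sum>k<r. A i k * w $ k) = b i" if "i < r" for i
  proof -
    have "(?M *\<^sub>v w) $ i = (\<Sum>k<r. A i k * w $ k)"
      using w that by (auto simp: scalar_prod_def atLeast0LessThan intro!: sum.cong)
    then show ?thesis using eq that by simp
  qed
  then show ?thesis using that by blast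
qed

text \<open>The subspace of a finite-dimensional space \<open>W\<close> cut out by linear functionals \<open>l s x\<close>, \<open>s \<in> \<Lambda>\<close>,
  depending on a parameter \<open>x\<close>, has one and the same dimension wherever a certain minor does not vanish:
  choose a nonvanishing minor of the largest possible size \<open>r\<close>, over all parameters. Where it does not
  vanish, the span of the \<open>r\<close> vectors in the minor is a complement of the subspace.\<close>

lemma generic_dim:
  fixes W :: "('i, 'k::field) mpoly set" and l :: "'s \<Rightarrow> 'x \<Rightarrow> ('i, 'k) mpoly \<Rightarrow> 'k"
  assumes W: "mp.subspace W" "finite B" "W \<subseteq> mp.span B"
    and add: "\<And>s x f g. l s x (f + g) = l s x f + l s x g"
    and scale: "\<And>s x a f. l s x (scale a f) = a * l s x f"
    and X: "X \<noteq> {}"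
  obtains r s w x0 where "\<forall>i<r. s i \<in> \<Lambda>" "\<forall>k<r. w k \<in> W" "x0 \<in> X"
    "det (mat r r (\<lambda>(i, k). l (s i) x0 (w k))) \<noteq> 0"
    "\<forall>x\<in>X. det (mat r r (\<lambda>(i, k). l (s i) x (w k))) \<noteq> 0 \<longrightarrow>
       mp.dim {f \<in> W. \<forall>s\<in>\<Lambda>. l s x f = 0} = mp.dim W - r"
proof -
  have l0: "l s x 0 = 0" for s x
    using scale[of s x 0 0] by simp
  have lsum: "l s x (sum f A) = (\<Sum>a\<in>A. l s x (f a))" for s x A and f :: "'b \<Rightarrow> ('i, 'k) mpoly"
    by (induction A rule: infinite_finite_induct) (auto simp: add l0)
  define good where "good r s w x \<longleftrightarrow> (\<forall>i<r. s i \<in> \<Lambda>) \<and> (\<forall>k<r. w k \<in> W) \<and> x \<in> X \<and>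
    det (mat r r (\<lambda>(i, k). l (s i) x (w k))) \<noteq> 0" for r s w x
  have kernel: "\<forall>k<r. c k = 0"
    if "good r s w x" "\<forall>i<r. l (s i) x (\<Sum>k<r. scale (c k) (w k)) = 0" for r s w x c
  proof -
    have "(\<Sum>k<r. l (s i) x (w k) * c k) = 0" if "i < r" for i
      using that \<open>\<forall>i<r. l (s i) x _ = 0\<close> by (simp add: lsum scale mult.commute)
    then show ?thesis
      using that(1) det_nonzero_kernel[of r "\<lambda>i k. l (s i) x (w k)"] unfolding good_def by blast
  qed
  have indep: "mp.independent (C \<union> w ` {..<r}) \<and> card (C \<union> w ` {..<r}) = card C + r"
    if g: "good r s w x" and C: "mp.independent C" "finite C" "C \<subseteq> {f \<in> W. \<forall>s\<in>\<Lambda>. l s x f = 0}"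
    for r s w x C
  proof -
    let ?V = "{f \<in> W. \<forall>s\<in>\<Lambda>. l s x f = 0}"
    have s: "\<forall>i<r. s i \<in> \<Lambda>" using g unfolding good_def by blast
    have V: "mp.subspace ?V"
      using W(1) unfolding mp.subspace_def by (auto simp: add scale l0)
    have unit: "(\<Sum>k<r. scale (if k = j then a else 0) (w k)) = scale a (w j)" if "j < r" for j a
      using that by (simp add: if_distrib[of "\<lambda>c. scale c _"] cong: if_cong)
    have inj: "inj_on w {..<r}"
    proof (rule inj_onI, rule ccontr)
      fix j k assume jk: "j \<in> {..<r}" "k \<in> {..<r}" "w j = w k" "j \<noteq> k"
      let ?c = "\<lambda>i. (if i = j then 1 else 0) + (if i = k then - 1 else (0::'k))"
      have "(\<Sum>i<r. scale (?c i) (w i)) = scale 1 (w j) + scale (- 1) (w k)"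
        using jk by (simp only: mp.scale_left_distrib sum.distrib unit lessThan_iff)
      also have "\<dots> = 0" using jk by simp
      finally have "\<forall>i<r. ?c i = 0"
        using kernel[OF g, of ?c] by (simp only: l0) blast
      then have "?c j = 0" using jk by blast
      then show False using jk by simp
    qed
    have disj: "C \<inter> w ` {..<r} = {}"
    proof (rule ccontr)
      assume "C \<inter> w ` {..<r} \<noteq> {}"
      then obtain j where j: "j < r" "w j \<in> C" by auto
      have "\<forall>i<r. l (s i) x (\<Sum>k<r. scale (if k = j then 1 else 0) (w k)) = 0"
        unfolding unit[OF j(1)] using j C(3) s by auto
      from kernel[OF g this] have "(if j = j then 1 else 0 :: 'k) = 0" using j(1) by blast
      then show False by simp
    qed
    have "mp.independent (C \<union> w ` {..<r})"
    proof (rule mp.independent_if_scalars_zero)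
      show "finite (C \<union> w ` {..<r})" using C(2) by simp
      fix u y assume u: "(\<Sum>y\<in>C \<union> w ` {..<r}. scale (u y) y) = 0" and y: "y \<in> C \<union> w ` {..<r}"
      have eq: "(\<Sum>y\<in>C. scale (u y) y) + (\<Sum>k<r. scale (u (w k)) (w k)) = 0"
        using u C(2) disj by (simp add: sum.union_disjoint sum.reindex[OF inj])
      have "(\<Sum>y\<in>C. scale (u y) y) \<in> ?V"
        by (intro mp.subspace_sum[OF V] mp.subspace_scale[OF V]) (use C(3) in blast)
      then have "- (\<Sum>y\<in>C. scale (u y) y) \<in> ?V" by (rule mp.subspace_neg[OF V])
      then have "(\<Sum>k<r. scale (u (w k)) (w k)) \<in> ?V"
        using eq by (simp add: add_eq_0_iff)
      then have uw: "\<forall>k<r. u (w k) = 0"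
        using kernel[OF g, of "\<lambda>k. u (w k)"] s by auto
      then have "(\<Sum>y\<in>C. scale (u y) y) = 0" using eq by simp
      then have "\<forall>y\<in>C. u y = 0"
        using mp.independentD[OF C(1,2) order_refl] by blast
      then show "u y = 0" using uw y by auto
    qed
    moreover have "card (C \<union> w ` {..<r}) = card C + r"
      using C(2) disj by (simp add: card_Un_disjoint card_image[OF inj])
    ultimately show ?thesis by blast
  qed
  obtain x1 where "x1 \<in> X" using X by blast
  then have good0: "\<exists>s w x. good 0 s w x"
    by (auto simp: good_def)
  have bound: "r \<le> card B" if g: "good r s w x" for r s w x
  proof -
    have "mp.independent ({} \<union> w ` {..<r}) \<and> card ({} \<union> w ` {..<r}) = card ({} :: ('i, 'k) mpoly set) + r"
      by (rule indep[OF g]) (auto simp: mp.independent_empty)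
    moreover have "w ` {..<r} \<subseteq> mp.span B" using g W(3) unfolding good_def by auto
    ultimately show ?thesis
      using mp.independent_span_bound[OF W(2), of "w ` {..<r}"] by simp
  qed
  obtain r where r: "\<exists>s w x. good r s w x" and
    rmax: "\<And>r' s w x. good r' s w x \<Longrightarrow> r' \<le> r"
  proof -
    have "\<forall>r. (\<exists>s w x. good r s w x) \<longrightarrow> r < Suc (card B)" using bound by (auto simp: less_Suc_eq_le)
    from ex_has_greatest_nat[where P = "\<lambda>r. \<exists>s w x. good r s w x", OF good0 this] show ?thesis
      using that by blast
  qed
  from r obtain s w x0 where g0: "good r s w x0" by blast
  have dim: "mp.dim {f \<in> W. \<forall>s\<in>\<Lambda>. l s x f = 0} = mp.dim W - r"
    if x: "x \<in> X" "det (mat r r (\<lambda>(i, k). l (s i) x (w k))) \<noteq> 0" for x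
  proof -
    let ?V = "{f \<in> W. \<forall>s\<in>\<Lambda>. l s x f = 0}"
    have g: "good r s w x" using g0 x unfolding good_def by blast
    obtain C where C: "C \<subseteq> ?V" "mp.independent C" "?V \<subseteq> mp.span C" "card C = mp.dim ?V"
      using mp.basis_exists[of ?V] by blast
    have "finite C"
      using mp.independent_span_bound[OF W(2) C(2)] C(1) W(3) by blast
    then have D: "mp.independent (C \<union> w ` {..<r})" "card (C \<union> w ` {..<r}) = card C + r"
      using indep[OF g C(2) _ C(1)] by blast+
    have "W \<subseteq> mp.span (C \<union> w ` {..<r})"
    proof
      fix f assume f: "f \<in> W"
      obtain c where c: "\<forall>i<r. (\<Sum>k<r. l (s i) x (w k) * c k) = l (s i) x f"
        using det_nonzero_solve[OF x(2), of "\<lambda>i. l (s i) x f"] by blast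
      define h where "h = f - (\<Sum>k<r. scale (c k) (w k))"
      have sw: "(\<Sum>k<r. scale (c k) (w k)) \<in> W"
        by (intro mp.subspace_sum[OF W(1)] mp.subspace_scale[OF W(1)]) (use g in \<open>auto simp: good_def\<close>)
      have hW: "h \<in> W" unfolding h_def by (intro mp.subspace_diff[OF W(1)] f sw)
      have f_eq: "f = h + (\<Sum>k<r. scale (c k) (w k))" by (simp add: h_def)
      have h0: "l (s i) x h = 0" if "i < r" for i
        using arg_cong[OF f_eq, of "l (s i) x"] c that by (simp add: add lsum scale mult.commute)
      have "l s' x h = 0" if s': "s' \<in> \<Lambda>" for s'
      proof (rule ccontr)
        assume nz: "l s' x h \<noteq> 0"
        \<comment> \<open>otherwise \<open>s'\<close> and \<open>h\<close> enlarge the minor\<close>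
        let ?s = "s(r := s')" and ?w = "w(r := h)"
        have "\<forall>k<Suc r. d k = 0" if d: "\<forall>i<Suc r. (\<Sum>k<Suc r. l (?s i) x (?w k) * d k) = 0" for d
        proof -
          have sum_eq: "(\<Sum>k<Suc r. l t x (?w k) * d k) = l t x (\<Sum>k<r. scale (d k) (w k)) + l t x h * d r" for t
            by (simp add: lsum scale mult.commute)
          have "l (s i) x (\<Sum>k<r. scale (d k) (w k)) = 0" if "i < r" for i
            using d[rule_format, of i] that h0[OF that] unfolding sum_eq by simp
          then have d0: "\<forall>k<r. d k = 0" using kernel[OF g, of d] by blast
          then have "l s' x h * d r = 0"
            using d[rule_format, of r] unfolding sum_eq by (simp add: l0)
          with nz d0 show ?thesis by (simp add: less_Suc_eq)
        qed
        then have "det (mat (Suc r) (Suc r) (\<lambda>(i, k). l (?s i) x (?w k))) \<noteq> 0"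
          unfolding det_nonzero_kernel by blast
        then have "good (Suc r) ?s ?w x"
          using g s' hW unfolding good_def by (auto simp: less_Suc_eq)
        then show False using rmax by fastforce
      qed
      with hW have "h \<in> ?V" by blast
      then have "h \<in> mp.span (C \<union> w ` {..<r})"
        using C(3) mp.span_mono[of C "C \<union> w ` {..<r}"] by blast
      moreover have "(\<Sum>k<r. scale (c k) (w k)) \<in> mp.span (C \<union> w ` {..<r})"
        by (intro mp.span_sum mp.span_scale mp.span_base) auto
      ultimately show "f \<in> mp.span (C \<union> w ` {..<r})"
        unfolding f_eq by (rule mp.span_add)
    qed
    moreover have "C \<union> w ` {..<r} \<subseteq> W"
      using C(1) g unfolding good_def by auto
    ultimately have "card C + r = mp.dim W"
      using mp.basis_card_eq_dim[of "C \<union> w ` {..<r}" W] D by simp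
    then show ?thesis using C(4) by simp
  qed
  show ?thesis
    by (rule that[of r s w x0]) (use g0 dim in \<open>auto simp: good_def\<close>)
qed

lemma generic_dim_exists:
  fixes I :: "(nat, 'k::alg_closed_field) mpoly set"
  assumes I: "mp.subspace I"
  obtains d U where "proj_open n U" "U \<noteq> {}"
    "\<And>P. P \<in> U \<Longrightarrow> vdim (I \<inter> ideal_power n (point_ideal n P) m \<inter> forms n t) = d"
proof -
  let ?W = "I \<inter> forms n t"
  let ?X = "{x :: nat \<Rightarrow> 'k. x 0 \<noteq> 0 \<and> (\<forall>i>n. x i = 0)}"
  define l :: "(nat \<Rightarrow> 'k) \<times> nat \<Rightarrow> (nat \<Rightarrow> 'k) \<Rightarrow> (nat, 'k) mpoly \<Rightarrow> 'k" where
    "l s x f = coeff (on_line x (fst s) f) (snd s)" for s x f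
  let ?L = "{s :: (nat \<Rightarrow> 'k) \<times> nat. snd s < m}"
  have W: "mp.subspace ?W" by (intro mp.subspace_inter I forms_subspace)
  obtain B :: "(nat, 'k) mpoly set" where B: "finite B" "forms n t \<subseteq> mp.span B"
    using forms_span by blast
  then have WB: "?W \<subseteq> mp.span B" by blast
  have "(\<lambda>i. if i = 0 then 1 else 0) \<in> ?X" by simp
  then have X: "?X \<noteq> {}" by (rule ex_in_conv[THEN iffD1, OF exI])
  have add: "l s x (f + g) = l s x f + l s x g" for s x f g
    by (simp add: l_def psubst_add[OF comm_ring_hom_const_poly])
  have scale: "l s x (scale a f) = a * l s x f" for s x a f
    by (simp add: l_def psubst_scale[OF comm_ring_hom_const_poly])
  obtain r s w x0 where g: "\<forall>i<r. s i \<in> ?L" "\<forall>k<r. w k \<in> ?W" "x0 \<in> ?X"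
    "det (mat r r (\<lambda>(i, k). l (s i) x0 (w k))) \<noteq> 0"
    "\<forall>x\<in>?X. det (mat r r (\<lambda>(i, k). l (s i) x (w k))) \<noteq> 0 \<longrightarrow>
       mp.dim {f \<in> ?W. \<forall>s\<in>?L. l s x f = 0} = mp.dim ?W - r"
    by (rule generic_dim[where l = l, OF W B(1) WB add scale X])
  \<comment> \<open>the factor \<open>x 0\<close> restricts the parameter to the chart where the equations describe the ideal power\<close>
  have "polyfun {..n} (\<lambda>x. det (mat r r (\<lambda>(i, k). l (s i) x (w k))) * x 0)"
  proof (intro polyfun_mult polyfun_det polyfun_coord)
    fix i k assume "i < r" "k < r"
    then have "w k \<in> poly_ring n" using g(2) forms_poly_ring by blast
    then have "upolyfun {..n} (\<lambda>x. on_line x q (w k))" for q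
      by (rule upolyfun_psubst) (auto intro: upolyfun_linear polyfun_coord polyfun_const)
    then show "polyfun {..n} (\<lambda>x. l (s i) x (w k))"
      unfolding upolyfun_def l_def by blast
  qed simp
  then obtain h where h: "h \<in> poly_ring n"
      "\<And>x. det (mat r r (\<lambda>(i, k). l (s i) x (w k))) * x 0 = mpoly_eval h x"
    unfolding polyfun_def poly_ring_in_vars by blast
  let ?U = "{P \<in> proj_space n. \<exists>x\<in>P. mpoly_eval h x \<noteq> 0}"
  show ?thesis
  proof (rule that[of ?U])
    show "proj_open n ?U" by (rule proj_open_nonvanishing[OF h(1)])
    have "mpoly_eval h x0 \<noteq> 0"
      using g(3,4) unfolding h(2)[symmetric] by simp
    moreover have "proj_pt x0 \<in> proj_space n"
      by (rule proj_pt_in) (use g(3) in auto)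
    ultimately show "?U \<noteq> {}" using proj_pt_self[of x0] by blast
  next
    fix P assume "P \<in> ?U"
    then obtain x where x: "P \<in> proj_space n" "x \<in> P" "mpoly_eval h x \<noteq> 0" by blast
    then have nz: "x 0 \<noteq> 0" "det (mat r r (\<lambda>(i, k). l (s i) x (w k))) \<noteq> 0"
      unfolding h(2)[symmetric] by auto
    note P = proj_spaceD[OF x(1,2)]
    have "I \<inter> ideal_power n (point_ideal n P) m \<inter> forms n t = {f \<in> ?W. \<forall>s\<in>?L. l s x f = 0}"
      unfolding P(1) using mem_ideal_power_point_iff[where p = x, OF nz(1), of _ n t m] by (auto simp: l_def)
    then show "vdim (I \<inter> ideal_power n (point_ideal n P) m \<inter> forms n t) = mp.dim ?W - r"
      unfolding vdim_def using g(5) nz P(2) by auto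
  qed
qed

text \<open>The generic dimension is attained on a nonempty open set; irreducibility makes it unique.\<close>

lemma adim_generic:
  fixes I :: "(nat, 'k::alg_closed_field) mpoly set"
  assumes "mp.subspace I"
  obtains U where "proj_open n U" "U \<noteq> {}"
    "\<forall>P\<in>U. vdim (I \<inter> ideal_power n (point_ideal n P) m \<inter> forms n t) = adim n I t m"
proof -
  obtain d U where U: "proj_open n U" "U \<noteq> {}"
    "\<And>P. P \<in> U \<Longrightarrow> vdim (I \<inter> ideal_power n (point_ideal n P) m \<inter> forms n t) = d"
    using generic_dim_exists[OF assms] by metis
  have "adim n I t m = d"
    unfolding adim_def
  proof (rule the_equality)
    show "\<exists>U. proj_open n U \<and> U \<noteq> {} \<and>
        (\<forall>P\<in>U. vdim (I \<inter> ideal_power n (point_ideal n P) m \<inter> forms n t) = d)"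
      using U by blast
    fix d' assume "\<exists>U. proj_open n U \<and> U \<noteq> {} \<and>
        (\<forall>P\<in>U. vdim (I \<inter> ideal_power n (point_ideal n P) m \<inter> forms n t) = d')"
    then obtain V where V: "proj_open n V" "V \<noteq> {}"
        "\<forall>P\<in>V. vdim (I \<inter> ideal_power n (point_ideal n P) m \<inter> forms n t) = d'"
      by blast
    obtain P where "P \<in> U" "P \<in> V"
      using proj_open_Int_nonempty[OF U(1,2) V(1,2)] by blast
    then show "d' = d" using U(3) V(3) by force
  qed
  then show ?thesis using that[OF U(1,2)] U(3) by simp
qed

lemma adim_pos:
  fixes I :: "(nat, 'k::alg_closed_field) mpoly set"
  assumes I: "mp.subspace I" and U: "proj_open n U" "U \<noteq> {}"
    and f: "\<And>P. P \<in> U \<Longrightarrow> \<exists>f \<in> I \<inter> ideal_power n (point_ideal n P) m \<inter> forms n t. f \<noteq> 0"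
  shows "adim n I t m > 0"
proof -
  obtain V where V: "proj_open n V" "V \<noteq> {}"
    "\<forall>P\<in>V. vdim (I \<inter> ideal_power n (point_ideal n P) m \<inter> forms n t) = adim n I t m"
    by (rule adim_generic[OF I, where m = m and t = t and n = n])
  obtain P where P: "P \<in> U" "P \<in> V"
    using proj_open_Int_nonempty[OF U V(1,2)] by blast
  let ?V = "I \<inter> ideal_power n (point_ideal n P) m \<inter> forms n t"
  obtain f where f: "f \<in> ?V" "f \<noteq> 0" using f[OF P(1)] by blast
  obtain B :: "(nat, 'k) mpoly set" where B: "finite B" "forms n t \<subseteq> mp.span B"
    using forms_span by blast
  obtain C where C: "C \<subseteq> ?V" "mp.independent C" "?V \<subseteq> mp.span C" "card C = mp.dim ?V"
    using mp.basis_exists[of ?V] by blast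
  have "finite C"
    using mp.independent_span_bound[OF B(1) C(2)] C(1) B(2) by blast
  moreover have "C \<noteq> {}" using C(3) f by (auto simp: mp.span_empty)
  ultimately have "mp.dim ?V > 0" using C(4) by (metis card_gt_0_iff)
  then show ?thesis using V(3) P(2) by (simp add: vdim_def)
qed

section \<open>Subresultants\<close>

lemma det_first_column:
  fixes D :: "nat \<Rightarrow> nat \<Rightarrow> 'r::comm_ring_1"
  assumes "N > 0"
  shows "det (mat N N (\<lambda>(i, c). if c = 0 then f i else D i c)) =
    (\<Sum>i<N. f i * det (mat N N (\<lambda>(l, c). if c = 0 then if l = i then 1 else 0 else D l c)))"
proof -
  define K where "K i = cofactor (mat N N (\<lambda>(i, c). if c = 0 then 0 else D i c)) i 0" for i
  have expand: "det (mat N N (\<lambda>(i, c). if c = 0 then g i else D i c)) = (\<Sum>i<N. g i * K i)" for g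
  proof -
    let ?A = "mat N N (\<lambda>(i, c). if c = 0 then g i else D i c)"
    have "mat_delete ?A i 0 = mat_delete (mat N N (\<lambda>(i, c). if c = 0 then 0 else D i c)) i 0" for i
      by (rule eq_matI) (auto simp: mat_delete_def)
    then have "cofactor ?A i 0 = K i" for i
      by (simp add: K_def cofactor_def)
    then show ?thesis
      using laplace_expansion_column[of ?A N 0] assms by simp
  qed
  have "det (mat N N (\<lambda>(l, c). if c = 0 then if l = i then 1 else 0 else D l c)) = K i" if "i < N" for i
    using that by (subst expand) (simp add: if_distrib[of "\<lambda>x. x * _"] cong: if_cong)
  then show ?thesis by (simp add: expand)
qed

lemma det_poly_ring:
  assumes "\<And>i c. i < N \<Longrightarrow> c < N \<Longrightarrow> A i c \<in> poly_ring n"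
  shows "det (mat N N (\<lambda>(i, c). A i c)) \<in> poly_ring n"
proof -
  have sum: "sum f X \<in> poly_ring n" if "\<And>x. x \<in> X \<Longrightarrow> f x \<in> poly_ring n"
    for f :: "(nat \<Rightarrow> nat) \<Rightarrow> (nat, 'a) mpoly" and X
    using that by (induction X rule: infinite_finite_induct) (auto intro: poly_ring_zero poly_ring_add)
  have minus: "- 1 \<in> poly_ring n"
    using poly_ring_const[of "- 1" n] by (simp add: single_uminus)
  show ?thesis
    unfolding det_mat prod.case
  proof (intro sum poly_ring_mult poly_ring_prod assms)
    fix \<sigma> i assume \<sigma>: "\<sigma> \<in> {\<sigma>. \<sigma> permutes {0..<N}}"
    show "signof \<sigma> \<in> poly_ring n"
      by (simp add: sign_def minus poly_ring_one)
    assume "i \<in> {0..<N}"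
    then show "i < N" "\<sigma> i < N"
      using \<sigma> permutes_in_image[of \<sigma> "{0..<N}" i] by auto
  qed
qed

text \<open>If the entry in row \<open>i\<close> and column \<open>c\<close> has degree \<open>r i - e c\<close> (and is 0 when this is negative), the
  determinant is homogeneous.\<close>

lemma det_cone_form:
  fixes e r :: "nat \<Rightarrow> nat"
  assumes A: "\<And>i c. i < N \<Longrightarrow> c < N \<Longrightarrow> e c \<le> r i \<Longrightarrow> cone_form n p (r i - e c) (A i c)"
    and A0: "\<And>i c. i < N \<Longrightarrow> c < N \<Longrightarrow> \<not> e c \<le> r i \<Longrightarrow> A i c = 0"
    and d: "(\<Sum>i<N. r i) = (\<Sum>c<N. e c) + d"
  shows "cone_form n p d (det (mat N N (\<lambda>(i, c). A i c)))"
proof -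
  define H where "H u x \<longleftrightarrow> x = 0 \<or> 0 \<le> u \<and> cone_form n p (nat u) x" for u :: int and x
  have Hmult: "H (u + v) (x * y)" if "H u x" "H v y" for u v x y
    using that unfolding H_def by (auto simp: nat_add_distrib intro: cone_form_mult)
  have one: "cone_form n p 0 1"
    using cone_form.const[of n p 1] by simp
  have Hprod: "H (\<Sum>i\<in>I. u i) (\<Prod>i\<in>I. x i)" if "finite I" "\<And>i. i \<in> I \<Longrightarrow> H (u i) (x i)"
    for u x and I :: "nat set"
    using that by (induction I rule: finite_induct) (auto intro!: Hmult, simp add: H_def one)
  show ?thesis
    unfolding det_mat prod.case
  proof (rule cone_form_sum)
    fix \<sigma> assume \<sigma>: "\<sigma> \<in> {\<sigma>. \<sigma> permutes {0..<N}}"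
    have "H (\<Sum>i=0..<N. int (r i) - int (e (\<sigma> i))) (\<Prod>i=0..<N. A i (\<sigma> i))"
    proof (rule Hprod)
      fix i assume "i \<in> {0..<N}"
      then have "i < N" "\<sigma> i < N"
        using \<sigma> permutes_in_image[of \<sigma> "{0..<N}" i] by auto
      then show "H (int (r i) - int (e (\<sigma> i))) (A i (\<sigma> i))"
        using A[of i "\<sigma> i"] A0[of i "\<sigma> i"]
        by (cases "e (\<sigma> i) \<le> r i") (auto simp: H_def nat_diff_distrib)
    qed simp
    moreover have "(\<Sum>i=0..<N. int (r i) - int (e (\<sigma> i))) = int d"
    proof -
      have "(\<Sum>i=0..<N. e (\<sigma> i)) = (\<Sum>i=0..<N. e i)"
        using sum.permute[of \<sigma> "{0..<N}" e] \<sigma> by (simp add: o_def)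
      then show ?thesis
        using arg_cong[OF d, of int] by (simp add: sum_subtractf atLeast0LessThan flip: of_nat_sum)
    qed
    ultimately have "H (int d) (\<Prod>i=0..<N. A i (\<sigma> i))" by simp
    then have "cone_form n p d (\<Prod>i=0..<N. A i (\<sigma> i))"
      unfolding H_def using cone_form_zero[of n p d] by (elim disjE conjE) (simp_all only: nat_int)
    then have "cone_form n p d (Poly_Mapping.single 0 (signof \<sigma>) * (\<Prod>i=0..<N. A i (\<sigma> i)))"
      by (rule cone_form_const_mult)
    then show "cone_form n p d (signof \<sigma> * (\<Prod>i=0..<N. A i (\<sigma> i)))"
      by (simp add: sign_def single_uminus split: if_splits)
  qed
qed

text \<open>The \<open>j\<close>-th principal subresultant coefficient of \<open>f\<close> and \<open>g\<close>, regarded as polynomials of degrees \<open>a\<close> and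
  \<open>b\<close>. The rows of the matrix are the coefficients of \<open>X ^ j\<close>, ..., \<open>X ^ (a + b - j - 1)\<close> in \<open>X ^ i * f\<close>
  for \<open>i < b - j\<close> and in \<open>X ^ i * g\<close> for \<open>i < a - j\<close>; over a field it is nonzero iff
  \<open>u * f + v * g\<close> is nonzero of degree at least \<open>j\<close> for all \<open>(u, v) \<noteq> (0, 0)\<close> with \<open>deg u < b - j\<close> and \<open>deg v < a - j\<close>.\<close>

definition psc :: "nat \<Rightarrow> nat \<Rightarrow> nat \<Rightarrow> 'k::comm_ring_1 poly \<Rightarrow> 'k poly \<Rightarrow> 'k" where
  "psc a b j f g = det (mat (a + b - 2 * j) (a + b - 2 * j)
     (\<lambda>(i, c). coeff (if i < b - j then monom 1 i * f else monom 1 (i - (b - j)) * g) (j + c)))"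

lemma double_arith_sum: "2 * (\<Sum>i<n. u + i) + n = n * (2 * u + n)" for n u :: nat
  by (induction n) (simp_all add: algebra_simps)

lemma sum_if_less: "(\<Sum>i<B + A. if i < B then f i else g (i - B)) = (\<Sum>i<B. f i) + (\<Sum>i<A. g i)"
  for f g :: "nat \<Rightarrow> nat"
  by (induction A) simp_all

text \<open>Sum of the row degrees minus sum of the column degrees of the matrix whose determinant is the
  coefficient of \<open>z ^ k\<close> in the subresultant. It is \<open>t - k\<close> for \<open>t = (a - j) (b - j) + j\<close>.\<close>

lemma sylvester_degree_sum:
  fixes a b j k :: nat
  assumes "j < a" "a \<le> b" "k \<le> j"
  shows "(\<Sum>i<a + b - 2 * j. if i < b - j then a + i else b + (i - (b - j))) =
    (\<Sum>c<a + b - 2 * j. if c = 0 then k else j + c) + ((a - j) * (b - j) + j - k)"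
proof -
  obtain A where a: "a = j + Suc A" using assms(1) less_imp_Suc_add by fastforce
  obtain B where b: "b = j + Suc B" using assms(1,2) less_imp_Suc_add[of j b] by fastforce
  have N: "a + b - 2 * j = Suc B + Suc A" "b - j = Suc B" "a - j = Suc A" by (auto simp: a b)
  have cols: "(\<Sum>c<a + b - 2 * j. if c = 0 then k else j + c) = k + (\<Sum>c<Suc (A + B). (j + 1) + c)"
    unfolding N by (simp add: sum.lessThan_Suc_shift add.commute[of B A] del: sum.lessThan_Suc)
  have rows: "(\<Sum>i<a + b - 2 * j. if i < b - j then a + i else b + (i - (b - j))) =
      (\<Sum>i<Suc B. a + i) + (\<Sum>i<Suc A. b + i)"
    unfolding N by (rule sum_if_less)
  have halve: "s1 + s2 = k + s3 + (u + j - k)"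
    if "2 * s1 + B' = x" "2 * s2 + A' = y" "2 * s3 + D = w" "x + y + D = w + A' + B' + 2 * (u + j)"
    for s1 s2 s3 A' B' D u w x y :: nat
    using that assms(3) by presburger
  have "Suc B * (2 * a + Suc B) + Suc A * (2 * b + Suc A) + Suc (A + B) =
     Suc (A + B) * (2 * (j + 1) + Suc (A + B)) + Suc A + Suc B + 2 * (Suc A * Suc B + j)"
    by (simp add: a b algebra_simps)
  from halve[OF double_arith_sum double_arith_sum double_arith_sum this] show ?thesis
    by (subst cols, subst rows) (simp only: N(2,3))
qed

text \<open>The form \<open>S\<close> is the \<open>j\<close>-th subresultant of \<open>F\<close> and \<open>G\<close>, regarded as polynomials in \<open>z\<close> with cone forms
  as coefficients. It is the determinant of the matrix of \<open>psc\<close> in which the column of the coefficients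
  of \<open>z ^ j\<close> is replaced by the forms \<open>z ^ i * F\<close> and \<open>z ^ i * G\<close> themselves. Expanding along this
  column shows that \<open>S\<close> lies in the ideal of \<open>F\<close> and \<open>G\<close>. Expanding this column in powers of \<open>z\<close> instead, the
  coefficient of \<open>z ^ k\<close> is 0 for \<open>k > j\<close>, because then two columns agree, and is a cone form of degree
  \<open>t - k \<ge> m\<close> for \<open>k \<le> j\<close>. So \<open>S\<close> has multiplicity at least \<open>m\<close> at the point. Restricted to the line
  \<open>q + X p\<close>, the coefficient of \<open>X ^ j\<close> in \<open>S\<close> is the principal subresultant coefficient.\<close>

lemma subresultant_exists:
  fixes F G :: "(nat, 'k::field) mpoly"
  assumes p: "p 0 \<noteq> 0" and q: "q 0 = 0"
    and F: "F \<in> forms n a" and G: "G \<in> forms n b" and j: "j < a" "a \<le> b"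
    and psc: "psc a b j (on_line q p F) (on_line q p G) \<noteq> 0"
  shows "\<exists>S \<in> gen_ideal n {F, G} \<inter> ideal_power n (point_ideal n (proj_pt p)) ((a - j) * (b - j)) \<inter>
      forms n ((a - j) * (b - j) + j). S \<noteq> 0"
proof -
  define N where "N = a + b - 2 * j"
  define R where "R i = (if i < b - j then zform p ^ i * F else zform p ^ (i - (b - j)) * G)" for i
  define r where "r i = (if i < b - j then a + i else b + (i - (b - j)))" for i
  have N: "N > 0" using j by (simp add: N_def)
  have z: "zform p ^ k \<in> forms n k" for k
  proof (induction k)
    case 0
    then show ?case using forms_const[of 1 n] by simp
  next
    case (Suc k)
    then show ?case using forms_mult[OF forms_zform Suc] by simp
  qed
  have R: "R i \<in> forms n (r i)" for i
  proof (cases "i < b - j")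
    case True
    then show ?thesis
      using forms_mult[OF z F, of i] by (simp only: R_def r_def if_True add.commute)
  next
    case False
    then show ?thesis
      using forms_mult[OF z G, of "i - (b - j)"] by (simp only: R_def r_def if_False add.commute)
  qed
  have RI: "R i \<in> gen_ideal n {F, G}" for i
    unfolding R_def using z forms_poly_ring by (auto intro!: gen_ideal_generator_mult)
  have "\<forall>i. \<exists>g. (\<forall>k\<le>r i. cone_form n p (r i - k) (g k)) \<and> R i = (\<Sum>k\<le>r i. zform p ^ k * g k)"
    using cone_expansion_form[OF R] unfolding cone_expansion_def by blast
  then obtain C0 where C0: "\<And>i k. k \<le> r i \<Longrightarrow> cone_form n p (r i - k) (C0 i k)"
      "\<And>i. R i = (\<Sum>k\<le>r i. zform p ^ k * C0 i k)"
    by metis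
  define C where "C i k = (if k \<le> r i then C0 i k else 0)" for i k
  have C: "cone_form n p (r i - k) (C i k)" for i k
    using C0(1) by (auto simp: C_def cone_form_zero)
  have RC: "R i = (\<Sum>k<j + N. zform p ^ k * C i k)" if "i < N" for i
  proof -
    have "{..r i} \<subseteq> {..<j + N}"
      using that j by (auto simp: r_def N_def split: if_splits)
    then show ?thesis
      unfolding C0(2) by (intro sum.mono_neutral_cong_left) (auto simp: C_def)
  qed
  have Cring: "C i k \<in> poly_ring n" for i k
    using C cone_form_forms forms_poly_ring by blast
  define B where "B k = det (mat N N (\<lambda>(i, c). if c = 0 then C i k else C i (j + c)))" for k
  define S where "S = det (mat N N (\<lambda>(i, c). if c = 0 then R i else C i (j + c)))"
  define K where "K i = det (mat N N (\<lambda>(l, c). if c = 0 then if l = i then 1 else 0 else C l (j + c)))" for i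
  have S_K: "S = (\<Sum>i<N. R i * K i)"
    unfolding S_def K_def by (rule det_first_column[OF N])
  have B_K: "B k = (\<Sum>i<N. C i k * K i)" for k
    unfolding B_def K_def by (rule det_first_column[OF N])
  have "S = (\<Sum>k<j + N. zform p ^ k * B k)"
  proof -
    have "S = (\<Sum>i<N. \<Sum>k<j + N. zform p ^ k * (C i k * K i))"
      unfolding S_K by (intro sum.cong) (simp_all add: RC sum_distrib_right mult.assoc)
    also have "\<dots> = (\<Sum>k<j + N. \<Sum>i<N. zform p ^ k * (C i k * K i))"
      by (rule sum.swap)
    finally show ?thesis by (simp add: B_K sum_distrib_left)
  qed
  also have "\<dots> = (\<Sum>k\<le>j. zform p ^ k * B k)"
  proof (rule sum.mono_neutral_right)
    show "\<forall>k\<in>{..<j + N} - {..j}. zform p ^ k * B k = 0"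
    proof
      fix k assume k: "k \<in> {..<j + N} - {..j}"
      have "B k = 0"
        unfolding B_def
        by (rule det_identical_columns[of _ N 0 "k - j"]) (use k N in \<open>auto intro!: eq_vecI\<close>)
      then show "zform p ^ k * B k = 0" by simp
    qed
  qed (use N in auto)
  finally have S_B: "S = (\<Sum>k\<le>j. zform p ^ k * B k)" .
  let ?m = "(a - j) * (b - j)"
  have Bk: "cone_form n p (?m + j - k) (B k)" if "k \<le> j" for k
    unfolding B_def
  proof (rule det_cone_form[where r = r and e = "\<lambda>c. if c = 0 then k else j + c"])
    show "(\<Sum>i<N. r i) = (\<Sum>c<N. if c = 0 then k else j + c) + (?m + j - k)"
      unfolding N_def r_def by (rule sylvester_degree_sum[OF j that])
  qed (auto simp: C_def C split: if_splits intro: C0(1))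
  have "S \<in> gen_ideal n {F, G}"
    unfolding S_K
  proof (rule gen_ideal_sum)
    fix i assume "i \<in> {..<N}"
    have "K i \<in> poly_ring n"
      unfolding K_def by (rule det_poly_ring) (auto simp: Cring poly_ring_zero poly_ring_one)
    then show "R i * K i \<in> gen_ideal n {F, G}"
      using gen_ideal_mult[OF RI] by (simp add: mult.commute)
  qed
  moreover have "S \<in> ideal_power n (point_ideal n (proj_pt p)) ?m"
    unfolding S_B ideal_power_def
  proof (rule gen_ideal_sum, rule gen_ideal_mult)
    fix k assume k: "k \<in> {..j}"
    then have "B k \<in> ideal_power n (point_ideal n (proj_pt p)) (?m + j - k)"
      using cone_form_ideal_power[of p n "?m + j - k" "B k"] p Bk by simp
    moreover have "?m \<le> ?m + j - k" using k by simp
    ultimately have "B k \<in> ideal_power n (point_ideal n (proj_pt p)) ?m"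
      using ideal_power_antimono[OF point_ideal_poly_ring] by blast
    then show "B k \<in> gen_ideal n {\<Prod>i<?m. f i | f. \<forall>i<?m. f i \<in> point_ideal n (proj_pt p)}"
      unfolding ideal_power_def .
    show "zform p ^ k \<in> poly_ring n" using z forms_poly_ring by blast
  qed
  moreover have "S \<in> forms n (?m + j)"
    unfolding S_B
  proof (rule mp.subspace_sum[OF forms_subspace])
    fix k assume "k \<in> {..j}"
    then show "zform p ^ k * B k \<in> forms n (?m + j)"
      using forms_mult[OF z cone_form_forms[OF Bk], of k k] by simp
  qed
  moreover have "S \<noteq> 0"
  proof
    assume "S = 0"
    let ?e = "on_line q p :: (nat, 'k) mpoly \<Rightarrow> 'k poly"
    interpret e: comm_ring_hom ?e
      by (rule comm_ring_hom_psubst[OF comm_ring_hom_const_poly])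
    have ez: "?e (zform p) ^ k = monom 1 k" for k
      using p q by (simp add: psubst_zform[OF comm_ring_hom_const_poly] monom_altdef)
    have line: "?e f = [:mpoly_eval f q:]" if "cone_form n p d f" for d f
      using cone_form_line_to[of p n d f q] p that by blast
    have mono: "monom 1 k * [:u:] = monom u k" for k and u :: 'k
      by (metis mult_monom monom_0 mult_1 add_0_right)
    have eR: "coeff (?e (R i)) k = mpoly_eval (C i k) q" if "i < N" "k < j + N" for i k
      using that by (simp add: RC e.hom_sum e.hom_mult e.hom_power ez line[OF C] coeff_sum
          if_distrib[of "\<lambda>x. _ * x"] cong: if_cong)
    have eR': "?e (R i) = (if i < b - j then monom 1 i * ?e F else monom 1 (i - (b - j)) * ?e G)" for i
      by (simp add: R_def e.hom_mult e.hom_power ez)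
    have "0 = coeff (?e S) j" using \<open>S = 0\<close> by simp
    also have "\<dots> = (\<Sum>k\<le>j. coeff (monom (mpoly_eval (B k) q) k) j)"
      unfolding S_B by (simp add: e.hom_sum e.hom_mult e.hom_power ez line[OF Bk] coeff_sum
          if_distrib[of "\<lambda>x. _ * x"] cong: if_cong)
    also have "\<dots> = mpoly_eval (B j) q" by simp
    also have "\<dots> = det (map_mat (\<lambda>f. mpoly_eval f q) (mat N N (\<lambda>(i, c). if c = 0 then C i j else C i (j + c))))"
      unfolding B_def mpoly_eval_psubst
      by (rule comm_ring_hom.hom_det[symmetric, OF comm_ring_hom_psubst[OF comm_ring_hom_ident]])
    also have "map_mat (\<lambda>f. mpoly_eval f q) (mat N N (\<lambda>(i, c). if c = 0 then C i j else C i (j + c))) =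
        mat N N (\<lambda>(i, c). coeff (?e (R i)) (j + c))"
      by (rule eq_matI) (auto simp: eR)
    also have "det \<dots> = psc a b j (?e F) (?e G)"
      unfolding psc_def N_def eR' ..
    finally show False using psc by simp
  qed
  ultimately show ?thesis by blast
qed

section \<open>A pair with nonvanishing principal subresultant coefficients\<close>

text \<open>The polynomial is 0 or has degree less than \<open>n\<close>.\<close>

definition deg_below :: "nat \<Rightarrow> 'k::zero poly \<Rightarrow> bool" where
  "deg_below n u \<longleftrightarrow> (\<forall>i\<ge>n. coeff u i = 0)"

lemma deg_below_0: "deg_below 0 u \<longleftrightarrow> u = 0"
  by (auto simp: deg_below_def poly_eq_iff)

lemma deg_below_iff: "deg_below n u \<longleftrightarrow> u = 0 \<or> degree u < n"
proof
  assume "deg_below n u"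
  then show "u = 0 \<or> degree u < n"
    unfolding deg_below_def by (metis leading_coeff_0_iff not_le)
qed (auto simp: deg_below_def coeff_eq_0)

lemma deg_below_add: "deg_below n u \<Longrightarrow> deg_below n v \<Longrightarrow> deg_below n (u + v)"
  by (simp add: deg_below_def)

lemma deg_below_diff: "deg_below n (u :: 'k::ab_group_add poly) \<Longrightarrow> deg_below n v \<Longrightarrow> deg_below n (u - v)"
  by (simp add: deg_below_def)

lemma deg_below_mono: "deg_below n u \<Longrightarrow> n \<le> m \<Longrightarrow> deg_below m u"
  by (simp add: deg_below_def)

lemma deg_below_mult:
  fixes u f :: "'k::comm_semiring_0 poly"
  assumes "deg_below n u" "degree f \<le> k"
  shows "deg_below (n + k) (u * f)"
  using assms degree_mult_le[of u f] by (auto simp: deg_below_iff)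

lemma deg_below_mult_cancel:
  fixes u f :: "'k::idom poly"
  assumes "deg_below (n + k) (u * f)" "degree f = k" "f \<noteq> 0"
  shows "deg_below n u"
  using assms degree_mult_eq[of u f] by (cases "u = 0") (auto simp: deg_below_iff)

text \<open>Polynomials with all partial quotients in the Euclidean algorithm equal to \<open>X\<close>. Since these have
  degree 1, the remainder sequence skips no degree, and this makes all principal subresultant
  coefficients nonzero in every characteristic.\<close>

fun continuant :: "nat \<Rightarrow> 'k::comm_ring_1 poly" where
  "continuant 0 = 1"
| "continuant (Suc 0) = [:0, 1:]"
| "continuant (Suc (Suc k)) = [:0, 1:] * continuant (Suc k) + continuant k"

lemma continuant_degree:
  "degree (continuant k :: 'k::field poly) = k \<and> (continuant k :: 'k poly) \<noteq> 0"
proof (induction k rule: continuant.induct)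
  case (3 k)
  let ?f = "continuant (Suc k) :: 'k poly"
  have X: "degree ([:0, 1:] * ?f) = Suc (Suc k)"
    using 3 by (subst degree_mult_eq) auto
  then have "degree (continuant (Suc (Suc k)) :: 'k poly) = Suc (Suc k)"
    unfolding continuant.simps using 3 by (subst degree_add_eq_left) auto
  then show ?case by (metis degree_0 nat.distinct(1))
qed auto

lemma continuant_bezout:
  fixes u v :: "'k::field poly"
  assumes "j \<le> k" "deg_below (k - j) u" "deg_below (Suc k - j) v"
    and "deg_below j (u * continuant (Suc k) + v * continuant k)"
  shows "u = 0 \<and> v = 0"
  using assms
proof (induction k arbitrary: u v)
  case 0
  then show ?case by (simp add: deg_below_0)
next
  case (Suc k)
  show ?case
  proof (cases "j = Suc k")
    case True
    then have "u = 0" using Suc.prems by (simp add: deg_below_0)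
    moreover have "v = 0"
      using Suc.prems \<open>u = 0\<close> True deg_below_mult_cancel[of 0 "Suc k" v "continuant (Suc k)"]
        continuant_degree[of "Suc k", where 'k = 'k] by (simp add: deg_below_0)
    ultimately show ?thesis by blast
  next
    case False
    then have j: "j \<le> k" using Suc.prems by simp
    let ?h = "u * continuant (Suc (Suc k)) + v * continuant (Suc k)"
    have h: "?h = (u * [:0, 1:] + v) * continuant (Suc k) + u * continuant k"
      by (simp add: algebra_simps)
    have "deg_below (Suc k - j + k) (u * continuant k)"
      using Suc.prems continuant_degree[of k, where 'k = 'k] by (intro deg_below_mult) auto
    moreover have "deg_below (Suc k - j + k) ?h"
      by (rule deg_below_mono[OF Suc.prems(4)]) (use j in simp)
    \<comment> \<open>the bound on \<open>u * X + v\<close> needed for the induction comes from the degree of the other terms\<close>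
    ultimately have "deg_below (Suc k - j + k) (?h - u * continuant k)"
      by (intro deg_below_diff)
    moreover have "?h - u * continuant k = (u * [:0, 1:] + v) * continuant (Suc k)"
      unfolding h by simp
    moreover have "Suc k - j + k = k - j + Suc k" using j by simp
    ultimately have "deg_below (k - j) (u * [:0, 1:] + v)"
      using deg_below_mult_cancel continuant_degree[of "Suc k", where 'k = 'k] by metis
    then have "u * [:0, 1:] + v = 0 \<and> u = 0"
      using Suc.IH[OF j] Suc.prems(2,4) unfolding h by blast
    then show ?thesis by auto
  qed
qed

text \<open>For \<open>0 < a \<le> b\<close>, a polynomial of degree at most \<open>b\<close> whose remainder modulo the continuant of degree \<open>a\<close> is the preceding
  continuant.\<close>

definition continuant_partner :: "nat \<Rightarrow> nat \<Rightarrow> 'k::field poly" where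
  "continuant_partner a b = monom 1 (b - a) * continuant a + continuant (a - 1)"

lemma continuant_partner_degree:
  assumes "0 < a" "a \<le> b"
  shows "degree (continuant_partner a b :: 'k::field poly) \<le> b"
  unfolding continuant_partner_def
proof (rule degree_add_le)
  show "degree (monom 1 (b - a) * continuant a :: 'k poly) \<le> b"
    using degree_mult_le[of "monom 1 (b - a)" "continuant a :: 'k poly"]
      degree_monom_le[of "1::'k" "b - a"] continuant_degree[of a, where 'k = 'k] assms by simp
  show "degree (continuant (a - 1) :: 'k poly) \<le> b"
    using continuant_degree[of "a - 1", where 'k = 'k] assms by simp
qed

lemma continuant_partner_bezout:
  fixes u v :: "'k::field poly"
  assumes "j < a" "a \<le> b" "deg_below (a - j) v" "deg_below j (u * continuant a + v * continuant_partner a b)"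
  shows "u = 0 \<and> v = 0"
proof -
  obtain k where a: "a = Suc k" using assms(1) by (cases a) auto
  let ?u = "u + monom 1 (b - a) * v" and ?h = "u * continuant a + v * continuant_partner a b"
  have h: "?h = ?u * continuant (Suc k) + v * continuant k"
    by (simp add: continuant_partner_def a algebra_simps)
  have j: "j \<le> k" using assms(1) a by simp
  have "deg_below (Suc k - j + k) (v * continuant k)"
    using assms(3) continuant_degree[of k, where 'k = 'k] by (intro deg_below_mult) (auto simp: a)
  moreover have "deg_below (Suc k - j + k) ?h"
    by (rule deg_below_mono[OF assms(4)]) (use j in simp)
  ultimately have "deg_below (Suc k - j + k) (?h - v * continuant k)"
    by (intro deg_below_diff)
  moreover have "?h - v * continuant k = ?u * continuant (Suc k)"
    unfolding h by simp
  moreover have "Suc k - j + k = k - j + Suc k" using j by simp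
  ultimately have "deg_below (k - j) ?u"
    using deg_below_mult_cancel continuant_degree[of "Suc k", where 'k = 'k] by metis
  moreover have "deg_below j (?u * continuant (Suc k) + v * continuant k)"
    using assms(4) unfolding h .
  ultimately have "?u = 0 \<and> v = 0"
    using continuant_bezout[OF j] assms(3) unfolding a by blast
  then show ?thesis by auto
qed

text \<open>A vector in the kernel of the transposed matrix is a pair of cofactors \<open>u\<close>, \<open>v\<close>.\<close>

lemma psc_continuant:
  assumes j: "j < a" "a \<le> b"
  shows "psc a b j (continuant a) (continuant_partner a b :: 'k::field poly) \<noteq> 0"
proof -
  define N where "N = a + b - 2 * j"
  define row :: "nat \<Rightarrow> 'k poly" where
    "row i = (if i < b - j then monom 1 i * continuant a else monom 1 (i - (b - j)) * continuant_partner a b)" for i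
  have N: "N = (b - j) + (a - j)" using j by (simp add: N_def)
  have "det (mat N N (\<lambda>(c, i). coeff (row i) (j + c))) \<noteq> 0"
    unfolding det_nonzero_kernel
  proof (intro allI impI)
    fix w k
    assume w: "\<forall>c<N. (\<Sum>i<N. coeff (row i) (j + c) * w i) = 0" and k: "k < N"
    define u where "u = (\<Sum>i<b - j. monom (w i) i)"
    define v where "v = (\<Sum>i<a - j. monom (w (b - j + i)) i)"
    have coeff_u: "coeff u i = (if i < b - j then w i else 0)" for i
      by (simp add: u_def coeff_sum)
    have coeff_v: "coeff v i = (if i < a - j then w (b - j + i) else 0)" for i
      by (simp add: v_def coeff_sum)
    have u: "deg_below (b - j) u" and v: "deg_below (a - j) v"
      by (auto simp: deg_below_def coeff_u coeff_v)
    let ?h = "u * continuant a + v * continuant_partner a b"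
    have smult_monom: "Polynomial.smult c (monom 1 i * f) = monom c i * f" for c :: 'k and i and f :: "'k poly"
      by (simp add: Polynomial.smult_monom flip: mult_smult_left)
    have "(\<Sum>i<N. Polynomial.smult (w i) (row i)) = ?h"
    proof -
      have split: "(\<Sum>i<B + A. f i) = (\<Sum>i<B. f i) + (\<Sum>i<A. f (B + i))" for A B and f :: "nat \<Rightarrow> 'k poly"
        by (induction A) (simp_all add: add.assoc)
      show ?thesis
        unfolding N split by (simp add: row_def u_def v_def sum_distrib_right smult_monom)
    qed
    then have coeff_h: "coeff ?h l = (\<Sum>i<N. coeff (row i) l * w i)" for l
      by (metis (no_types, lifting) coeff_smult coeff_sum mult.commute sum.cong)
    have "deg_below (b - j + a) (u * continuant a)"
      using continuant_degree[of a, where 'k = 'k] by (intro deg_below_mult u) simp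
    moreover have "deg_below (a - j + b) (v * continuant_partner a b)"
      using j by (intro deg_below_mult v continuant_partner_degree) auto
    moreover have "b - j + a = j + N" "a - j + b = j + N" using j by (auto simp: N_def)
    ultimately have "deg_below (j + N) ?h" by (simp add: deg_below_add)
    have "deg_below j ?h"
      unfolding deg_below_def
    proof (intro allI impI)
      fix l assume "j \<le> l"
      show "coeff ?h l = 0"
      proof (cases "l < j + N")
        case True
        then show ?thesis
          unfolding coeff_h using w[rule_format, of "l - j"] \<open>j \<le> l\<close> by simp
      next
        case False
        then show ?thesis
          using \<open>deg_below (j + N) ?h\<close> by (simp add: deg_below_def)
      qed
    qed
    then have "u = 0" "v = 0" using continuant_partner_bezout[OF j v] by blast+
    show "w k = 0"
    proof (cases "k < b - j")
      case True
      then show ?thesis using coeff_u[of k] \<open>u = 0\<close> by simp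
    next
      case False
      then have "k - (b - j) < a - j" "b - j + (k - (b - j)) = k" using k N by auto
      then show ?thesis using coeff_v[of "k - (b - j)"] \<open>v = 0\<close> by simp
    qed
  qed
  moreover have "transpose_mat (mat N N (\<lambda>(i, c). coeff (row i) (j + c))) = mat N N (\<lambda>(c, i). coeff (row i) (j + c))"
    by (rule eq_matI) auto
  then have "det (mat N N (\<lambda>(c, i). coeff (row i) (j + c))) = det (mat N N (\<lambda>(i, c). coeff (row i) (j + c)))"
    by (metis det_transpose mat_carrier)
  ultimately show ?thesis
    unfolding psc_def row_def N_def by simp
qed

lemma polyfun_psc:
  assumes "upolyfun V P" "upolyfun V Q"
  shows "polyfun V (\<lambda>x. psc a b j (P x) (Q x))"
  unfolding psc_def
proof (rule polyfun_det)
  fix i c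
  have "upolyfun V (\<lambda>x. if i < b - j then monom 1 i * P x else monom 1 (i - (b - j)) * Q x)"
    using assms by (cases "i < b - j") (auto intro: upolyfun_mult upolyfun_const)
  then show "polyfun V (\<lambda>x. coeff (if i < b - j then monom 1 i * P x else monom 1 (i - (b - j)) * Q x) (j + c))"
    unfolding upolyfun_def by blast
qed

section \<open>Genericity of the pair of forms\<close>

abbreviation coord_vec :: "nat \<Rightarrow> nat \<Rightarrow> 'k::zero_neq_one" where
  "coord_vec k \<equiv> \<lambda>i. if i = k then 1 else 0"

text \<open>Homogenization with the variables \<open>x\<^sub>0\<close> and \<open>x\<^sub>1\<close>.\<close>

lemma form_with_restriction:
  fixes f :: "'k::field poly"
  assumes "degree f \<le> d" "n \<ge> 1"
  shows "\<exists>F \<in> forms n d. on_line (coord_vec 1) (coord_vec 0) F = f"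
proof
  let ?m = "\<lambda>k. Poly_Mapping.single 0 k + Poly_Mapping.single 1 (d - k) :: nat \<Rightarrow>\<^sub>0 nat"
  let ?F = "\<Sum>k\<le>d. Poly_Mapping.single (?m k) (coeff f k)"
  show "?F \<in> forms n d"
  proof (intro mp.subspace_sum[OF forms_subspace] forms_single)
    fix k assume "k \<in> {..d}"
    then show "mdeg (?m k) = d" by (simp add: mdeg_add) (simp add: mdeg_def)
    show "Poly_Mapping.keys (?m k) \<subseteq> {..n}"
      by (rule subset_trans[OF Poly_Mapping.keys_add]) (use assms(2) in auto)
  qed
  have "monom_val (\<lambda>i. [:coord_vec 1 i, coord_vec 0 i:]) (?m k) = (monom 1 k :: 'k poly)" for k
    unfolding monom_val_add by (simp add: monom_val_def monom_altdef flip: one_pCons)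
  then have "on_line (coord_vec 1) (coord_vec 0) ?F = (\<Sum>k\<le>d. monom (coeff f k) k)"
    by (simp add: psubst_sum[OF comm_ring_hom_const_poly] psubst_single[OF comm_ring_hom_const_poly] smult_monom)
  also have "\<dots> = f"
    using assms(1) by (rule poly_as_sum_of_monoms')
  finally show "on_line (coord_vec 1) (coord_vec 0) ?F = f" .
qed

lemma upolyfun_const_poly:
  assumes "polyfun V f"
  shows "upolyfun V (\<lambda>x. [:f x:])"
  using upolyfun_linear[OF assms polyfun_const[of V 0]] by simp

lemma pairs_open_psc:
  fixes p q :: "nat \<Rightarrow> 'k::field"
  shows "pairs_open n a b {(F, G) \<in> forms n a \<times> forms n b. \<forall>j<a. psc a b j (on_line q p F) (on_line q p G) \<noteq> 0}"
proof -
  let ?M = "\<lambda>d. {m :: nat \<Rightarrow>\<^sub>0 nat. Poly_Mapping.keys m \<subseteq> {..n} \<and> mdeg m = d}"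
  let ?v = "monom_val (\<lambda>i. [:q i, p i:])"
  let ?P = "\<lambda>x. \<Sum>m\<in>?M a. [:x (Inl m):] * ?v m" and ?Q = "\<lambda>x. \<Sum>m\<in>?M b. [:x (Inr m):] * ?v m"
  have P: "upolyfun UNIV ?P" and Q: "upolyfun UNIV ?Q"
    by (intro upolyfun_sum upolyfun_mult upolyfun_const upolyfun_const_poly polyfun_coord UNIV_I)+
  have "polyfun UNIV (\<lambda>x. \<Prod>j<a. psc a b j (?P x) (?Q x))"
    by (intro polyfun_prod polyfun_psc P Q)
  then obtain h where h: "\<And>x. (\<Prod>j<a. psc a b j (?P x) (?Q x)) = mpoly_eval h x"
    unfolding polyfun_def by blast
  have line: "on_line q p F = (\<Sum>m\<in>?M d. [:Poly_Mapping.lookup F m:] * ?v m)"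
    if "F \<in> forms n d" for F d
    by (rule psubst_superset[OF comm_ring_hom_const_poly finite_monomials])
      (use that in \<open>auto simp: forms_def poly_ring_def\<close>)
  have "(\<forall>j<a. psc a b j (on_line q p F) (on_line q p G) \<noteq> 0) \<longleftrightarrow> mpoly_eval h (pair_coords (F, G)) \<noteq> 0"
    if "F \<in> forms n a" "G \<in> forms n b" for F G
    unfolding h[symmetric] line[OF that(1)] line[OF that(2)] by (auto simp: pair_coords_def)
  then show ?thesis
    unfolding pairs_open_def by (intro exI[of _ "{h}"]) auto
qed

theorem proposition5p1:
  fixes n a b :: nat
  assumes "n \<ge> 2" and "a \<le> b"
  shows "\<exists>U :: ((nat, 'k::alg_closed_field) mpoly \<times> (nat, 'k) mpoly) set.
    pairs_open n a b U \<and> U \<noteq> {} \<and>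
    (\<forall>F G. (F, G) \<in> U \<and> complete_intersection n [F, G] \<longrightarrow>
      (\<forall>j<a. let t = (a - j) * (b - j) + j; m = (a - j) * (b - j)
             in adim n (subscheme_ideal n {F, G}) t m > 0))"
proof -
  let ?q = "coord_vec 1 :: nat \<Rightarrow> 'k" and ?p = "coord_vec 0 :: nat \<Rightarrow> 'k"
  let ?U = "{(F, G) \<in> forms n a \<times> forms n b. \<forall>j<a. psc a b j (on_line ?q ?p F) (on_line ?q ?p G) \<noteq> 0}"
  have "?U \<noteq> {}"
  proof (cases "a = 0")
    case True
    then show ?thesis using forms_zero by auto
  next
    case False
    obtain F where F: "F \<in> forms n a" "on_line ?q ?p F = continuant a"
      using form_with_restriction[of "continuant a :: 'k poly" a n] continuant_degree[of a, where 'k = 'k] assms(1)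
      by auto
    obtain G where G: "G \<in> forms n b" "on_line ?q ?p G = continuant_partner a b"
      using form_with_restriction[of "continuant_partner a b :: 'k poly" b n] continuant_partner_degree[of a b, where 'k = 'k] assms False
      by auto
    have "(F, G) \<in> ?U"
      using F G psc_continuant[OF _ assms(2), where 'k = 'k] by auto
    then show ?thesis by blast
  qed
  moreover have "adim n (subscheme_ideal n {F, G}) ((a - j) * (b - j) + j) ((a - j) * (b - j)) > 0"
    if FG: "(F, G) \<in> ?U" and j: "j < a" for F G j
  proof -
    have F: "F \<in> forms n a" and G: "G \<in> forms n b" and psc: "psc a b j (on_line ?q ?p F) (on_line ?q ?p G) \<noteq> 0"
      using FG j by auto
    have line: "upolyfun {..n} (\<lambda>x. on_line ?q x f)" if "f \<in> poly_ring n" for f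
      using that by (intro upolyfun_psubst upolyfun_linear polyfun_const polyfun_coord) auto
    \<comment> \<open>the condition defining \<open>?U\<close> concerns the point \<open>?p\<close>; it persists for all points of an open set\<close>
    have "polyfun {..n} (\<lambda>x. psc a b j (on_line ?q x F) (on_line ?q x G) * x 0)"
      by (intro polyfun_mult polyfun_psc line polyfun_coord forms_poly_ring[OF F] forms_poly_ring[OF G]) simp
    then obtain h where h: "h \<in> poly_ring n"
        "\<And>x. psc a b j (on_line ?q x F) (on_line ?q x G) * x 0 = mpoly_eval h x"
      unfolding polyfun_def poly_ring_in_vars by blast
    let ?V = "{P \<in> proj_space n. \<exists>x\<in>P. mpoly_eval h x \<noteq> 0}"
    show ?thesis
    proof (rule adim_pos[OF subscheme_ideal_subspace, of n ?V])
      show "proj_open n ?V" by (rule proj_open_nonvanishing[OF h(1)])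
      have "mpoly_eval h ?p \<noteq> 0"
        unfolding h(2)[symmetric] using psc by simp
      moreover have "proj_pt ?p \<in> proj_space n"
        by (rule proj_pt_in) auto
      ultimately show "?V \<noteq> {}" using proj_pt_self[of ?p] by blast
    next
      fix P assume "P \<in> ?V"
      then obtain x where x: "P \<in> proj_space n" "x \<in> P" "mpoly_eval h x \<noteq> 0" by blast
      then have x0: "x 0 \<noteq> 0" and "psc a b j (on_line ?q x F) (on_line ?q x G) \<noteq> 0"
        unfolding h(2)[symmetric] by auto
      then have "\<exists>S \<in> gen_ideal n {F, G} \<inter> ideal_power n (point_ideal n (proj_pt x)) ((a - j) * (b - j)) \<inter>
          forms n ((a - j) * (b - j) + j). S \<noteq> 0"
        by (intro subresultant_exists[where q = ?q] F G j assms(2)) auto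
      moreover have "gen_ideal n {F, G} \<subseteq> subscheme_ideal n {F, G}"
        unfolding subscheme_ideal_def
        by (rule gen_ideal_saturation) (use F G forms_poly_ring in blast)
      ultimately show "\<exists>S \<in> subscheme_ideal n {F, G} \<inter> ideal_power n (point_ideal n P) ((a - j) * (b - j)) \<inter>
          forms n ((a - j) * (b - j) + j). S \<noteq> 0"
        unfolding proj_spaceD(1)[OF x(1,2)] by blast
    qed
  qed
  ultimately show ?thesis
    using pairs_open_psc[of n a b ?q ?p] unfolding Let_def by (intro exI[of _ ?U]) blast
qed

end
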